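(* Let $m\in\mathbb N$ and let $H^m=\bigoplus_{p+q=m}H^{p,q}$ be the Hodge decomposition of $H^m(X_v(\mathbb C),\mathbb C)$ for a smooth projective variety $X$ over a number field at a complex archimedean place $v$ ($\mathbb K_v=\mathbb C$). Let $\pi(H^m,u)$ be the canonical representation of $\mathbb C^*$ on $H^m$. Then, for $z=\frac{1+m}{2}+is$ with $s\in\mathbb R$, $$\int'_{\mathbb C^*}\frac{\mathrm{Trace}(\pi(H^m,u))\,|u|_{\mathbb C}^{z}}{|1-u|_{\mathbb C}}\,d^*u=-2\,\frac{d}{ds}\,\Im\log L_{\mathbb C}(H^m,z).$$
   Context: $|u|_{\mathbb C}=u\bar u$. The canonical representation of $\mathbb C^*$ is $\pi(H^m,u)\xi=u^{-p}\bar u^{-q}\xi$ for $\xi\in H^{p,q}$. With $h^{p,q}=\dim H^{p,q}$ and $\Gamma_{\mathbb C}(z)=(2\pi)^{-z}\Gamma(z)$, the archimedean local factor (Serre) is $L_{\mathbb C}(H^m,z)=\prod_{p+q=m}\Gamma_{\mathbb C}(z-\min(p,q))^{h^{p,q}}$. Principal value $\int'$: let $f_0(\nu)=\inf(\nu^{1/2},\nu^{-1/2})$ for $\nu\in\mathbb R_+^*$, $f_1=f_0^{-1}-f_0$, $d^*\nu=d\nu/\nu$. For a function $\varphi$ on $\mathbb C^*$ let $\psi(\nu)$ be the integral of $\varphi$ over the fiber $\{|u|_{\mathbb C}=\nu\}$ for the rotation-invariant probability measure. If $\psi-c\,f_1^{-1}$ is integrable on $\mathbb R_+^*$ for $d^*\nu$,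 then $$\int'_{\mathbb C^*}\varphi(u)\,d^*u=2\log(2\pi)\,c+\lim_{t\to\infty}\Big(\int_{\mathbb R_+^*}(1-f_0^{2t})\,\psi(\nu)\,d^*\nu-2c\log t\Big).$$ *)

theory Defs
  imports "HOL-Complex_Analysis.Complex_Analysis" "HOL-Probability.Probability"
begin

definition (in vector_space) endo_trace :: "('b \<Rightarrow> 'b) \<Rightarrow> 'a" where
  "endo_trace f =
     (let B = (SOME B. independent B \<and> span B = UNIV) in \<Sum>b\<in>B. representation B (f b) b)"

definition hodge_types :: "nat \<Rightarrow> (nat \<times> nat) set" where
  "hodge_types m = {(p, q). p + q = m}"

(* A finite-dimensional complex vector space (the type 'a with the given scaling) with a
   Hodge decomposition of weight m: the conjugation cj comes from the real structure
   H^m(X, R), and H p q is the summand of type (p, q).  The cohomology H^m(X_v(C), C) of a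
   smooth projective variety is an instance by Hodge theory. *)
locale hodge_structure = vector_space scale
  for scale :: "complex \<Rightarrow> 'a::ab_group_add \<Rightarrow> 'a" +
  fixes cj :: "'a \<Rightarrow> 'a" and m :: nat and H :: "nat \<Rightarrow> nat \<Rightarrow> 'a set"
  assumes finite_dim: "\<exists>B. finite B \<and> span B = UNIV"
    and cj_add: "cj (x + y) = cj x + cj y"
    and cj_scale: "cj (scale a x) = scale (cnj a) (cj x)"
    and cj_cj: "cj (cj x) = x"
    and subspace_H: "p + q = m \<Longrightarrow> subspace (H p q)"
    and cj_H: "p + q = m \<Longrightarrow> cj ` H p q = H q p"
    and direct_sum:
      "\<exists>!y. (\<forall>(p, q) \<in> hodge_types m. y (p, q) \<in> H p q)
            \<and> (\<forall>i. i \<notin> hodge_types m \<longrightarrow> y i = 0)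
            \<and> x = (\<Sum>i\<in>hodge_types m. y i)"
begin

definition component :: "'a \<Rightarrow> nat \<times> nat \<Rightarrow> 'a" where
  "component x =
     (THE y. (\<forall>(p, q) \<in> hodge_types m. y (p, q) \<in> H p q)
             \<and> (\<forall>i. i \<notin> hodge_types m \<longrightarrow> y i = 0)
             \<and> x = (\<Sum>i\<in>hodge_types m. y i))"

definition canonical_rep :: "complex \<Rightarrow> 'a \<Rightarrow> 'a" where
  "canonical_rep u x =
     (\<Sum>(p, q)\<in>hodge_types m. scale (u powi (- int p) * cnj u powi (- int q)) (component x (p, q)))"

definition hodge_number :: "nat \<Rightarrow> nat \<Rightarrow> nat" where
  "hodge_number p q = dim (H p q)"

end

lemma finite_hodge_types: "finite (hodge_types m)"
  by (rule finite_subset[of _ "{..m} \<times> {..m}"]) (auto simp: hodge_types_def)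

lemma (in hodge_structure) canonical_rep_on_H:
  assumes "p + q = m" "x \<in> H p q"
  shows "canonical_rep u x = scale (u powi (- int p) * cnj u powi (- int q)) x"
proof -
  have mem: "(p, q) \<in> hodge_types m" using assms(1) by (simp add: hodge_types_def)
  have "component x = (\<lambda>i. if i = (p, q) then x else 0)"
    unfolding component_def
  proof (rule the1_equality[OF direct_sum], intro conjI)
    show "\<forall>(p', q')\<in>hodge_types m. (if (p', q') = (p, q) then x else 0) \<in> H p' q'"
      using assms(2) subspace_0[OF subspace_H] by (auto simp: hodge_types_def)
  qed (use mem finite_hodge_types in \<open>auto simp: sum.delta\<close>)
  then have "canonical_rep u x = (\<Sum>i\<in>hodge_types m. if i = (p, q)
      then scale (u powi (- int p) * cnj u powi (- int q)) x else 0)"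
    unfolding canonical_rep_def by (intro sum.cong) (auto split: if_splits)
  then show ?thesis using mem finite_hodge_types by (simp add: sum.delta)
qed

definition Gamma_C :: "complex \<Rightarrow> complex" where
  "Gamma_C z = of_real (2 * pi) powr (- z) * Gamma z"

definition (in hodge_structure) L_C :: "complex \<Rightarrow> complex" where
  "L_C z = (\<Prod>(p, q)\<in>hodge_types m. Gamma_C (z - of_nat (min p q)) ^ hodge_number p q)"

definition mod_C :: "complex \<Rightarrow> real" where
  "mod_C u = Re (u * cnj u)"

definition f0 :: "real \<Rightarrow> real" where
  "f0 \<nu> = min (\<nu> powr (1/2)) (\<nu> powr (- 1/2))"

definition f1 :: "real \<Rightarrow> real" where
  "f1 \<nu> = inverse (f0 \<nu>) - f0 \<nu>"

definition dstar :: "real measure" where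
  "dstar = density (restrict_space lborel {0<..}) (\<lambda>\<nu>. ennreal (1 / \<nu>))"

(* The rotation-invariant probability measure on the fibre mod_C u = \<nu>, which is the
   circle of radius sqrt \<nu>. *)
definition fibre_measure :: "real \<Rightarrow> complex measure" where
  "fibre_measure \<nu> =
     distr (uniform_measure lborel {0..<2 * pi}) borel (\<lambda>\<theta>. of_real (sqrt \<nu>) * cis \<theta>)"

definition fibre_integral :: "(complex \<Rightarrow> complex) \<Rightarrow> real \<Rightarrow> complex" where
  "fibre_integral \<phi> \<nu> = (LINT u|fibre_measure \<nu>. \<phi> u)"

(* The fibre integrals are only required to converge for almost every \<nu>: for the integrand
   of the trace formula, the fibre \<nu> = 1 passes through the singularity u = 1.  Since
   1 / f1 is not integrable near 1, the constant c is unique. *)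
definition has_pv_integral :: "(complex \<Rightarrow> complex) \<Rightarrow> complex \<Rightarrow> bool" where
  "has_pv_integral \<phi> I \<longleftrightarrow>
     (AE \<nu> in dstar. integrable (fibre_measure \<nu>) \<phi>) \<and>
     (\<exists>c l. integrable dstar (\<lambda>\<nu>. fibre_integral \<phi> \<nu> - c * of_real (inverse (f1 \<nu>))) \<and>
        ((\<lambda>t::real. (LINT \<nu>|dstar. of_real (1 - f0 \<nu> powr (2 * t)) * fibre_integral \<phi> \<nu>)
                     - 2 * c * of_real (ln t)) \<longlongrightarrow> l) at_top \<and>
        I = 2 * of_real (ln (2 * pi)) * c + l)"

(* A branch of log f along the real line; it is determined up to a constant in 2 pi i Z, so
   the derivative of its imaginary part does not depend on the choice. *)
definition continuous_log :: "(real \<Rightarrow> complex) \<Rightarrow> (real \<Rightarrow> complex) \<Rightarrow> bool" where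
  "continuous_log f F \<longleftrightarrow> continuous_on UNIV F \<and> (\<forall>s. exp (F s) = f s)"

definition critical_point :: "nat \<Rightarrow> real \<Rightarrow> complex" where
  "critical_point m s = of_real ((1 + real m) / 2) + \<i> * of_real s"

end

theory Submission
  imports Defs "HOL-Real_Asymp.Real_Asymp"
begin

text \<open>
  Both sides are sums over the Hodge types \<open>(p, q)\<close>, weighted by the Hodge numbers, so the
  formula reduces to one statement for each \<open>n = \<bar>p - q\<bar>\<close>.

  The trace of \<open>\<pi>(H\<^sup>m, u)\<close> is the sum of \<open>h\<^sup>p\<^sup>q u\<^sup>-\<^sup>p (cnj u)\<^sup>-\<^sup>q\<close>, because the trace of a projection
  is the dimension of its image (\<open>endo_trace_projection\<close>).  On the circle \<open>mod_C u = \<nu>\<close> the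
  character \<open>u\<^sup>-\<^sup>p (cnj u)\<^sup>-\<^sup>q\<close> is a power of \<open>\<nu>\<close> times \<open>cis ((q - p) \<theta>)\<close>, and
  \<open>1 / mod_C (1 - u)\<close> is a multiple of the Poisson kernel, whose Fourier coefficients are geometric
  (\<open>poisson_integral\<close>).  At \<open>z = (1 + m)/2 + i s\<close> all powers of \<open>\<nu>\<close> combine to the
  symmetric expression \<open>\<psi>(\<nu>) = \<nu>\<^sup>i\<^sup>s f0(\<nu>)\<^sup>n / f1(\<nu>)\<close>, here called \<open>mellin_term n s\<close>.
  It differs from \<open>1 / f1\<close> by an integrable function, so each type contributes \<open>1\<close> to the
  constant \<open>c\<close> in the definition of the principal value.

  Expand \<open>1 / f1\<close> as a geometric series in \<open>f0\<close>.  With \<open>a = (1 + n)/2\<close>, integrating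
  \<open>(1 - f0\<^sup>2\<^sup>t) \<psi>\<close> term by term gives the series
  \<open>\<Sum>k. 1/(a+k+is) + 1/(a+k-is) - 1/(a+t+k+is) - 1/(a+t+k-is)\<close>, which is the sum over the two signs
  of the differences \<open>Digamma (a+t\<plusminus>is) - Digamma (a\<plusminus>is)\<close> (\<open>cutoff_integral\<close>).
  Since \<open>Digamma (a+t\<plusminus>is) - ln t\<close> tends to \<open>0\<close>, subtracting \<open>2 ln t\<close> leaves the limit
  \<open>- 2 Re (Digamma (a+is))\<close>, and the principal value of one type is
  \<open>2 ln (2 \<pi>) - 2 Re (Digamma (a+is))\<close>.

  On the other side \<open>z - min p q = a + is\<close>, and \<open>ln_Gamma w - w ln (2 \<pi>)\<close> is a logarithm of
  \<open>Gamma_C w\<close>.  The imaginary part of its value at \<open>a + is\<close> has \<open>s\<close>-derivative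
  \<open>Re (Digamma (a+is)) - ln (2 \<pi>)\<close>, which times \<open>-2\<close> is the same number.
\<close>

section \<open>The trace of the canonical representation\<close>

context vector_space begin

text \<open>
  The trace is defined through one chosen basis.  Naming that basis lets the arguments below work
  with it as an arbitrary one.
\<close>

lemma endo_trace_basis:
  obtains B where "independent B" "span B = UNIV"
    "\<And>f. local.endo_trace f = (\<Sum>b\<in>B. representation B (f b) b)"
proof -
  define B where "B = (SOME B. independent B \<and> span B = UNIV)"
  have "independent (extend_basis {}) \<and> span (extend_basis {}) = UNIV"
    by (simp add: local.independent_extend_basis local.span_extend_basis local.independent_empty)
  then have "independent B \<and> span B = UNIV"
    unfolding B_def by (rule someI)
  moreover have "local.endo_trace f = (\<Sum>b\<in>B. representation B (f b) b)" for f
    by (simp add: local.endo_trace_def B_def Let_def)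
  ultimately show thesis using that by blast
qed

lemma endo_trace_linear_combination:
  "local.endo_trace (\<lambda>x. \<Sum>i\<in>I. scale (a i) (P i x)) = (\<Sum>i\<in>I. a i * local.endo_trace (P i))"
proof -
  obtain B where B: "independent B" "span B = UNIV"
    "\<And>f. local.endo_trace f = (\<Sum>b\<in>B. representation B (f b) b)"
    using local.endo_trace_basis by blast
  have "representation B (\<Sum>i\<in>I. scale (a i) (P i b)) b
      = (\<Sum>i\<in>I. a i * representation B (P i b) b)" for b
    by (subst representation_sum) (auto simp: B representation_scale)
  then show ?thesis
    by (simp add: B(3) sum_distrib_left sum.swap[of _ _ I])
qed

lemma finite_independent:
  assumes "\<exists>B. finite B \<and> span B = UNIV" "independent C"
  shows "finite C"
  using assms independent_span_bound by blast

text \<open>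
  Only a basis \<open>C\<close> of the image is needed: expanding \<open>P b\<close> in \<open>C\<close> and then each \<open>c \<in> C\<close> in
  the basis \<open>B\<close> of the whole space, the sum over \<open>b\<close> collapses to the \<open>c\<close>-coordinate of
  \<open>P c = c\<close>, so every element of \<open>C\<close> contributes \<open>1\<close>.  This also shows that the chosen basis
  does not matter, without comparing two bases of the whole space.
\<close>

lemma endo_trace_projection:
  assumes fin: "\<exists>B. finite B \<and> span B = UNIV"
    and W: "subspace W"
    and add: "\<And>x y. P (x + y) = P x + P y"
    and scale: "\<And>a x. P (scale a x) = scale a (P x)"
    and range: "\<And>x. P x \<in> W"
    and id: "\<And>x. x \<in> W \<Longrightarrow> P x = x"
  shows "local.endo_trace P = of_nat (dim W)"
proof -
  obtain B where B: "independent B" "span B = UNIV"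
    "\<And>f. local.endo_trace f = (\<Sum>b\<in>B. representation B (f b) b)"
    using local.endo_trace_basis by blast
  obtain C where C: "C \<subseteq> W" "independent C" "W \<subseteq> span C" "card C = dim W"
    by (rule basis_exists)
  have finC: "finite C" and finB: "finite B"
    using finite_independent[OF fin] C(2) B(1) by auto
  have P0: "P 0 = 0" using id subspace_0[OF W] by auto
  have Psum: "P (\<Sum>b\<in>S. scale (a b) (g b)) = (\<Sum>b\<in>S. scale (a b) (P (g b)))" if "finite S" for S a and g :: "'b \<Rightarrow> 'b"
    using that by (induction S rule: finite_induct) (auto simp: P0 add scale)
  have inC: "P x \<in> span C" for x using range C(3) by auto
  have "representation B (P b) b = (\<Sum>c\<in>C. representation C (P b) c * representation B c b)" for b
  proof -
    have "P b = (\<Sum>c\<in>C. scale (representation C (P b) c) c)"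
      using sum_representation_eq[OF C(2) inC finC order_refl] by simp
    then have "representation B (P b) b = representation B (\<Sum>c\<in>C. scale (representation C (P b) c) c) b"
      by simp
    also have "\<dots> = (\<Sum>c\<in>C. representation C (P b) c * representation B c b)"
      by (subst representation_sum) (auto simp: B representation_scale)
    finally show ?thesis .
  qed
  then have "local.endo_trace P = (\<Sum>c\<in>C. \<Sum>b\<in>B. representation C (P b) c * representation B c b)"
    by (simp add: B(3) sum.swap[of _ C])
  also have "\<dots> = (\<Sum>c\<in>C. 1)"
  proof (rule sum.cong[OF refl])
    fix c assume c: "c \<in> C"
    have "c = (\<Sum>b\<in>B. scale (representation B c b) b)"
      using sum_representation_eq[OF B(1) _ finB order_refl, of c] B(2) by simp
    then have "P c = (\<Sum>b\<in>B. scale (representation B c b) (P b))"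
      using Psum[OF finB, of "representation B c" "\<lambda>b. b"] by simp
    moreover have "P c = c" using id c C(1) by auto
    ultimately have "representation C c c = representation C (\<Sum>b\<in>B. scale (representation B c b) (P b)) c"
      by simp
    also have "\<dots> = (\<Sum>b\<in>B. representation C (P b) c * representation B c b)"
      using inC by (subst representation_sum) (auto simp: C(2) representation_scale span_scale mult.commute)
    finally show "(\<Sum>b\<in>B. representation C (P b) c * representation B c b) = 1"
      using representation_basis[OF C(2) c] by simp
  qed
  finally show ?thesis using C(4) by simp
qed

end

context hodge_structure begin

lemma component_decomposition:
  shows "\<And>i. i \<in> hodge_types m \<Longrightarrow> component x i \<in> H (fst i) (snd i)"
    and "\<And>i. i \<notin> hodge_types m \<Longrightarrow> component x i = 0"
    and "x = (\<Sum>i\<in>hodge_types m. component x i)"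
  using theI'[OF direct_sum[of x], folded component_def] by auto

text \<open>
  This is how \<open>component\<close> is seen to be linear: sums and multiples of decompositions are
  decompositions.
\<close>

lemma component_unique:
  assumes "\<And>i. i \<in> hodge_types m \<Longrightarrow> y i \<in> H (fst i) (snd i)"
    and "\<And>i. i \<notin> hodge_types m \<Longrightarrow> y i = 0"
    and "x = (\<Sum>i\<in>hodge_types m. y i)"
  shows "component x = y"
  unfolding component_def by (rule the1_equality[OF direct_sum]) (use assms in auto)

lemma subspace_H': "i \<in> hodge_types m \<Longrightarrow> subspace (H (fst i) (snd i))"
  using subspace_H by (auto simp: hodge_types_def)

lemma component_add: "component (x + y) = (\<lambda>i. component x i + component y i)"
proof (rule component_unique)
  show "x + y = (\<Sum>i\<in>hodge_types m. component x i + component y i)"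
    using component_decomposition(3) by (simp add: sum.distrib)
qed (auto simp: component_decomposition subspace_add[OF subspace_H'])

lemma component_scale: "component (scale a x) = (\<lambda>i. scale a (component x i))"
proof (rule component_unique)
  show "scale a x = (\<Sum>i\<in>hodge_types m. scale a (component x i))"
    using component_decomposition(3) by (simp flip: scale_sum_right)
qed (auto simp: component_decomposition subspace_scale[OF subspace_H'])

lemma component_on_H:
  assumes "i \<in> hodge_types m" "x \<in> H (fst i) (snd i)"
  shows "component x i = x"
proof -
  have "component x = (\<lambda>j. if j = i then x else 0)"
    by (rule component_unique)
      (use assms finite_hodge_types in \<open>auto simp: subspace_0[OF subspace_H'] sum.delta\<close>)
  then show ?thesis by simp
qed

lemma endo_trace_canonical_rep:
  "local.endo_trace (canonical_rep u)
     = (\<Sum>(p, q)\<in>hodge_types m. of_nat (hodge_number p q) * (u powi (- int p) * cnj u powi (- int q)))"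
proof -
  have "local.endo_trace (\<lambda>x. component x i) = of_nat (hodge_number (fst i) (snd i))"
    if "i \<in> hodge_types m" for i
    unfolding hodge_number_def using that
    by (intro endo_trace_projection)
      (auto simp: component_add component_scale component_on_H component_decomposition subspace_H' finite_dim)
  then show ?thesis
    unfolding canonical_rep_def case_prod_beta endo_trace_linear_combination
    by (intro sum.cong) auto
qed
end

section \<open>The Poisson kernel and fibre integrals\<close>

text \<open>
  Reflection in the unit circle; it carries the Poisson integral from radius below \<open>1\<close> to
  radius above \<open>1\<close>.
\<close>

lemma norm_one_minus_inverse_cis:
  assumes "r > 0"
  shows "norm (1 - complex_of_real r * cis \<theta>) = r * norm (1 - complex_of_real (1/r) * cis \<theta>)"
proof -
  have "1 - complex_of_real r * cis \<theta> = - (of_real r * cis \<theta>) * cnj (1 - complex_of_real (1/r) * cis \<theta>)"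
    using assms by (simp add: algebra_simps cis_cnj cis_mult)
  then show ?thesis
    using assms by (simp add: norm_mult del: complex_cnj_diff)
qed

text \<open>
  On the unit circle \<open>\<bar>1 - r u\<bar>\<^sup>2 = (1 - r u) (u - r) / u\<close>, so the integral is a Cauchy
  integral of \<open>u\<^sup>n / (1 - r u)\<close> at the point \<open>r\<close>.
\<close>

lemma poisson_integral_disc:
  assumes "0 \<le> r" "r < 1"
  shows "((\<lambda>\<theta>. cis (real n * \<theta>) / of_real ((norm (1 - of_real r * cis \<theta>))\<^sup>2))
     has_integral of_real (2 * pi * (r ^ n / (1 - r\<^sup>2)))) {0..2*pi}"
proof -
  define f where "f u = u ^ n / (1 - of_real r * u)" for u :: complex
  have ru: "1 - of_real r * u \<noteq> 0" if "norm u \<le> 1" for u :: complex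
  proof
    assume "1 - of_real r * u = 0"
    then have "norm (of_real r * u) = 1" by simp
    moreover have "norm (of_real r * u) \<le> r * 1"
      unfolding norm_mult using assms that by (intro mult_mono) auto
    ultimately show False using assms by simp
  qed
  have "((\<lambda>u. f u / (u - of_real r)) has_contour_integral (2 * of_real pi * \<i> * f (of_real r))) (circlepath 0 1)"
    by (rule Cauchy_integral_circlepath_simple)
      (use assms ru in \<open>auto simp: f_def intro!: holomorphic_intros\<close>)
  then have "((\<lambda>t. f (cis t) / (cis t - of_real r) * \<i> * cis t) has_integral
      (2 * of_real pi * \<i> * f (of_real r))) {0..2*pi}"
    unfolding circlepath_def by (subst (asm) has_contour_integral_part_circlepath_iff) auto
  \<comment> \<open>multiplying by \<open>- \<i>\<close> passes from \<open>du / u\<close> to \<open>d\<theta>\<close>\<close>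
  then have "((\<lambda>t. - \<i> * (f (cis t) / (cis t - of_real r) * \<i> * cis t)) has_integral
      (- \<i> * (2 * of_real pi * \<i> * f (of_real r)))) {0..2*pi}"
    by (rule has_integral_mult_right)
  moreover have "- \<i> * (2 * of_real pi * \<i> * f (of_real r)) = of_real (2 * pi * (r ^ n / (1 - r\<^sup>2)))"
  proof -
    have rot: "- \<i> * (2 * of_real pi * \<i> * x) = 2 * of_real pi * x" for x :: complex
      by (simp add: complex_eq_iff)
    show ?thesis unfolding rot by (simp add: f_def power2_eq_square)
  qed
  moreover have "- \<i> * (f (cis t) / (cis t - of_real r) * \<i> * cis t)
      = cis (real n * t) / of_real ((norm (1 - of_real r * cis t))\<^sup>2)" for t
  proof -
    have "complex_of_real ((norm (1 - of_real r * cis t))\<^sup>2)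
        = (1 - of_real r * cis t) * (1 - of_real r * cnj (cis t))"
      unfolding complex_norm_square by simp
    moreover have "(1 - of_real r * cnj (cis t)) * cis t = cis t - of_real r"
      by (simp add: algebra_simps cis_cnj cis_mult)
    moreover have "cis t \<noteq> 0" by (rule cis_neq_zero)
    moreover have "1 - complex_of_real r * cis t \<noteq> 0" by (rule ru) simp
    moreover have "1 - complex_of_real r * cnj (cis t) \<noteq> 0" by (rule ru) simp
    ultimately have "cis t / (cis t - of_real r) = 1 / (1 - of_real r * cnj (cis t))"
      and norm: "complex_of_real ((norm (1 - of_real r * cis t))\<^sup>2)
        = (1 - of_real r * cis t) * (1 - of_real r * cnj (cis t))"
      by (auto simp: field_simps)
    moreover have "- \<i> * (f (cis t) / (cis t - of_real r) * \<i> * cis t)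
        = f (cis t) * (cis t / (cis t - of_real r))"
      by (simp add: divide_inverse ac_simps)
    ultimately show ?thesis unfolding norm by (simp add: f_def Complex.DeMoivre)
  qed
  ultimately show ?thesis by simp
qed

lemma poisson_integral:
  assumes "r > 0" "r \<noteq> 1"
  shows "((\<lambda>\<theta>. cis (of_int k * \<theta>) / of_real ((norm (1 - of_real r * cis \<theta>))\<^sup>2))
     has_integral of_real (2 * pi * (min r (1 / r) ^ nat \<bar>k\<bar> / \<bar>1 - r\<^sup>2\<bar>))) {0..2*pi}"
proof -
  have nonneg: "((\<lambda>\<theta>. cis (real n * \<theta>) / of_real ((norm (1 - of_real r * cis \<theta>))\<^sup>2))
     has_integral of_real (2 * pi * (min r (1 / r) ^ n / \<bar>1 - r\<^sup>2\<bar>))) {0..2*pi}" for n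
  proof (cases "r < 1")
    case True
    then have "min r (1 / r) = r" "r\<^sup>2 < 1"
      using assms by (auto simp: min_def field_simps power_less_one_iff mult_le_one intro: less_imp_le)
    then show ?thesis using poisson_integral_disc[of r n] True assms by simp
  next
    case False
    then have r: "r > 1" using assms by simp
    have "((\<lambda>\<theta>. cis (real n * \<theta>) / of_real ((norm (1 - of_real (1/r) * cis \<theta>))\<^sup>2) * of_real (1 / r\<^sup>2))
     has_integral of_real (2 * pi * ((1/r) ^ n / (1 - (1/r)\<^sup>2))) * of_real (1 / r\<^sup>2)) {0..2*pi}"
      by (rule has_integral_mult_left, rule poisson_integral_disc) (use r in auto)
    moreover have "2 * pi * ((1/r) ^ n / (1 - (1/r)\<^sup>2)) * (1 / r\<^sup>2)
        = 2 * pi * (min r (1 / r) ^ n / \<bar>1 - r\<^sup>2\<bar>)"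
    proof -
      have "1 < r * r" using r by (simp add: less_1_mult)
      moreover have "1 \<le> r\<^sup>2" using r by simp
      ultimately have "\<bar>1 - r\<^sup>2\<bar> = r\<^sup>2 * (1 - (1/r)\<^sup>2)"
        using r by (simp add: field_simps power2_eq_square)
      moreover have "min r (1 / r) = 1 / r"
        using r \<open>1 < r * r\<close> by (simp add: min_def field_simps)
      ultimately show ?thesis by simp
    qed
    ultimately have "((\<lambda>\<theta>. cis (real n * \<theta>) / of_real ((norm (1 - of_real (1/r) * cis \<theta>))\<^sup>2) * of_real (1 / r\<^sup>2))
     has_integral of_real (2 * pi * (min r (1 / r) ^ n / \<bar>1 - r\<^sup>2\<bar>))) {0..2*pi}"
      by (simp only: of_real_mult[symmetric])
    moreover have "cis (real n * \<theta>) / of_real ((norm (1 - of_real (1/r) * cis \<theta>))\<^sup>2) * of_real (1 / r\<^sup>2)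
        = cis (real n * \<theta>) / of_real ((norm (1 - of_real r * cis \<theta>))\<^sup>2)" for \<theta>
      unfolding norm_one_minus_inverse_cis[OF assms(1)] by (simp add: power_mult_distrib)
    ultimately show ?thesis by simp
  qed
  show ?thesis
  proof (cases "k \<ge> 0")
    case True
    then show ?thesis using nonneg[of "nat k"] by simp
  next
    case False
    then have k: "real (nat (- k)) = - of_int k" by simp
    have "(cnj \<circ> (\<lambda>\<theta>. cis (real (nat (- k)) * \<theta>) / of_real ((norm (1 - of_real r * cis \<theta>))\<^sup>2))
       has_integral cnj (of_real (2 * pi * (min r (1 / r) ^ nat (- k) / \<bar>1 - r\<^sup>2\<bar>)))) {0..2*pi}"
      by (rule has_integral_linear[OF nonneg bounded_linear_cnj])
    then show ?thesis using False unfolding k o_def by (simp add: cis_cnj)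
  qed
qed

text \<open>
  The fibre integral is the mean over the angle, which may be computed as a gauge integral when the
  integrand is continuous on the circle.
\<close>

lemma has_bochner_integral_fibre:
  fixes \<phi> :: "complex \<Rightarrow> complex"
  assumes [measurable]: "\<phi> \<in> borel_measurable borel"
    and cont: "continuous_on {0..2*pi} (\<lambda>\<theta>. \<phi> (of_real (sqrt \<nu>) * cis \<theta>))"
    and int: "((\<lambda>\<theta>. \<phi> (of_real (sqrt \<nu>) * cis \<theta>)) has_integral of_real (2 * pi) * I) {0..2*pi}"
  shows "has_bochner_integral (fibre_measure \<nu>) \<phi> I"
proof -
  let ?g = "\<lambda>\<theta>. \<phi> (of_real (sqrt \<nu>) * cis \<theta>)"
  have [measurable]: "(\<lambda>\<theta>. complex_of_real (sqrt \<nu>) * cis \<theta>) \<in> borel_measurable borel"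
    by (intro borel_measurable_continuous_onI continuous_intros)
  have si: "set_integrable lborel {0..2*pi} ?g"
    unfolding set_integrable_def using borel_integrable_compact[OF compact_Icc cont] .
  have "(LINT \<theta>:{0..2*pi}|lborel. ?g \<theta>) = of_real (2 * pi) * I"
    using set_borel_integral_eq_integral(2)[OF si] integral_unique[OF int] by simp
  then have "has_bochner_integral lborel (\<lambda>\<theta>. indicator {0..2*pi} \<theta> *\<^sub>R ?g \<theta>) (of_real (2 * pi) * I)"
    using si by (simp add: has_bochner_integral_iff set_integrable_def set_lebesgue_integral_def)
  then have "has_bochner_integral lborel (\<lambda>\<theta>. (1 / (2 * pi)) *\<^sub>R (indicator {0..2*pi} \<theta> *\<^sub>R ?g \<theta>))
      ((1 / (2 * pi)) *\<^sub>R (of_real (2 * pi) * I))"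
    by (rule has_bochner_integral_scaleR_right)
  also have "(1 / (2 * pi)) *\<^sub>R (of_real (2 * pi) * I) = I"
    by (simp add: scaleR_conv_of_real)
  finally have 1: "has_bochner_integral lborel (\<lambda>\<theta>. (indicator {0..<2*pi} \<theta> / (2 * pi)) *\<^sub>R ?g \<theta>) I"
  proof (rule has_bochner_integral_cong_AE[THEN iffD1, rotated -1])
    have "AE \<theta> in lborel. \<theta> \<noteq> 2 * pi" by (rule AE_lborel_singleton)
    then show "AE \<theta> in lborel. (1 / (2 * pi)) *\<^sub>R (indicator {0..2*pi} \<theta> *\<^sub>R ?g \<theta>)
        = (indicator {0..<2*pi} \<theta> / (2 * pi)) *\<^sub>R ?g \<theta>"
      by eventually_elim (auto simp: indicator_def)
  qed measurable
  have dens: "uniform_measure lborel {0..<2*pi} = density lborel (\<lambda>\<theta>. ennreal (indicator {0..<2*pi} \<theta> / (2 * pi)))"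
    unfolding uniform_measure_def
    by (intro density_cong) (auto simp: indicator_def divide_ennreal[symmetric] intro!: AE_I2)
  show ?thesis
    unfolding fibre_measure_def dens
    by (intro has_bochner_integral_distr has_bochner_integral_density 1) (auto simp: indicator_def)
qed

section \<open>Mellin integrals over the positive reals\<close>

text \<open>
  In the coordinate \<open>ln \<nu>\<close> the function \<open>f0\<close> is \<open>exp (- \<bar>ln \<nu>\<bar> / 2)\<close>, hence \<open>f1\<close>
  is \<open>2 sinh (\<bar>ln \<nu>\<bar> / 2)\<close>.
\<close>

lemma f0_exp: "\<nu> > 0 \<Longrightarrow> f0 \<nu> = exp (- \<bar>ln \<nu>\<bar> / 2)"
  by (auto simp: f0_def powr_def min_def)

lemma f0_pos: "\<nu> > 0 \<Longrightarrow> 0 < f0 \<nu>"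
  by (simp add: f0_exp)

lemma f0_less_1: "\<nu> > 0 \<Longrightarrow> \<nu> \<noteq> 1 \<Longrightarrow> f0 \<nu> < 1"
  by (simp add: f0_exp)

lemma f0_measurable [measurable]: "f0 \<in> borel_measurable borel"
  unfolding f0_def by measurable

lemma f1_measurable [measurable]: "f1 \<in> borel_measurable borel"
  unfolding f1_def by measurable

text \<open>
  The unitary character \<open>\<nu> \<mapsto> \<nu>\<^sup>i\<^sup>s\<close> of the positive reals.
\<close>

definition character :: "real \<Rightarrow> real \<Rightarrow> complex" where
  "character s \<nu> = cis (s * ln \<nu>)"

lemma character_measurable [measurable]: "character s \<in> borel_measurable borel"
proof -
  have [measurable]: "cis \<in> borel_measurable borel"
    by (intro borel_measurable_continuous_onI continuous_intros)
  show ?thesis unfolding character_def by measurable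
qed

lemma norm_character [simp]: "norm (character s \<nu>) = 1"
  by (simp add: character_def)

lemma character_0 [simp]: "character 0 \<nu> = 1"
  by (simp add: character_def)

lemma measurable_dstar: "f \<in> borel_measurable borel \<Longrightarrow> f \<in> borel_measurable dstar"
  unfolding dstar_def by (simp add: measurable_restrict_space1)

text \<open>
  The point \<open>\<nu> = 1\<close>, where the fibre meets the singularity and \<open>f1\<close> vanishes, is a null set.
\<close>

lemma AE_dstar: "AE \<nu> in dstar. 0 < \<nu> \<and> \<nu> \<noteq> 1"
proof -
  have "AE \<nu> in lborel. \<nu> \<noteq> (1::real)" by (rule AE_lborel_singleton)
  then have "AE \<nu> in restrict_space lborel {0<..}. \<nu> > 0 \<and> \<nu> \<noteq> (1::real)"
    by (subst AE_restrict_space_iff) auto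
  then show ?thesis
    unfolding dstar_def by (subst AE_density) (auto intro!: measurable_restrict_space1)
qed

lemma has_bochner_integral_dstar:
  fixes f :: "real \<Rightarrow> complex"
  assumes [measurable]: "f \<in> borel_measurable borel"
    and 1: "set_integrable lborel {0<..<1} (\<lambda>\<nu>. f \<nu> / of_real \<nu>)" "(LINT \<nu>:{0<..<1}|lborel. f \<nu> / of_real \<nu>) = A"
    and 2: "set_integrable lborel {1<..} (\<lambda>\<nu>. f \<nu> / of_real \<nu>)" "(LINT \<nu>:{1<..}|lborel. f \<nu> / of_real \<nu>) = B"
  shows "has_bochner_integral dstar f (A + B)"
proof -
  have "has_bochner_integral lborel (\<lambda>\<nu>. indicator {0<..<1} \<nu> *\<^sub>R (f \<nu> / of_real \<nu>) + indicator {1<..} \<nu> *\<^sub>R (f \<nu> / of_real \<nu>)) (A + B)"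
    using 1 2 by (intro has_bochner_integral_add)
      (auto simp: has_bochner_integral_iff set_integrable_def set_lebesgue_integral_def)
  then have "has_bochner_integral lborel (\<lambda>\<nu>. indicator {0<..} \<nu> *\<^sub>R ((1 / \<nu>) *\<^sub>R f \<nu>)) (A + B)"
  proof (rule has_bochner_integral_cong_AE[THEN iffD1, rotated -1])
    have "AE \<nu> in lborel. \<nu> \<noteq> (1::real)" by (rule AE_lborel_singleton)
    then show "AE \<nu> in lborel. indicator {0<..<1} \<nu> *\<^sub>R (f \<nu> / of_real \<nu>) + indicator {1<..} \<nu> *\<^sub>R (f \<nu> / of_real \<nu>)
        = indicator {0<..} \<nu> *\<^sub>R ((1 / \<nu>) *\<^sub>R f \<nu>)"
      by eventually_elim (auto simp: indicator_def scaleR_conv_of_real field_simps)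
  qed measurable
  then have "has_bochner_integral (restrict_space lborel {0<..}) (\<lambda>\<nu>. (1 / \<nu>) *\<^sub>R f \<nu>) (A + B)"
    by (subst has_bochner_integral_restrict_space) auto
  then show ?thesis
    unfolding dstar_def
    by (intro has_bochner_integral_density)
      (auto intro!: measurable_restrict_space1 simp: AE_restrict_space_iff)
qed

lemma mellin_primitive:
  fixes w :: complex
  assumes "w \<noteq> 0" "x > 0"
  shows "((\<lambda>x. exp (of_real (ln x) * w) / w) has_vector_derivative exp (of_real (ln x) * w) / of_real x) (at x)"
proof -
  have 1: "((\<lambda>x. complex_of_real (ln x) * w) has_vector_derivative of_real (1 / x) * w) (at x)"
    using assms(2) by (auto intro!: derivative_eq_intros has_vector_derivative_real_field simp: field_simps
        has_real_derivative_iff_has_vector_derivative[symmetric])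
  have 2: "((\<lambda>y. exp y / w) has_field_derivative exp (of_real (ln x) * w) / w) (at (of_real (ln x) * w))"
    using assms(1) by (auto intro!: derivative_eq_intros)
  show ?thesis
    using field_vector_diff_chain_at[OF 1 2] assms by (simp add: o_def)
qed

lemma mellin_integrable:
  fixes b :: real
  assumes "b > 0"
  shows "set_integrable lborel {0<..<1} (\<lambda>x. exp (ln x * b) / x)"
    and "set_integrable lborel {1<..} (\<lambda>x. exp (ln x * (- b)) / x)"
proof -
  have *: "DERIV (\<lambda>x. exp (ln x * c) / c) x :> exp (ln x * c) / x" if "x > 0" "c \<noteq> 0" for x c :: real
    using that by (auto intro!: derivative_eq_intros simp: field_simps)
  have cont: "isCont (\<lambda>x. exp (ln x * c) / x) x" if "x > 0" for x c :: real
    using that by (auto intro!: continuous_intros)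
  have "((\<lambda>x. exp (ln x * b) / b) \<longlongrightarrow> 0) (at_right 0)"
    using assms by real_asymp
  moreover have "((\<lambda>x. exp (ln x * b) / b) \<longlongrightarrow> 1 / b) (at_left 1)"
    using assms by (auto intro!: tendsto_eq_intros)
  ultimately show "set_integrable lborel {0<..<1} (\<lambda>x. exp (ln x * b) / x)"
    using interval_integral_FTC_nonneg(1)[of "ereal 0" "ereal 1" "\<lambda>x. exp (ln x * b) / b" "\<lambda>x. exp (ln x * b) / x" 0 "1/b"] assms * cont
    by (auto simp: ereal_tendsto_simps intro!: continuous_intros)
  have "((\<lambda>x. exp (ln x * (- b)) / (- b)) \<longlongrightarrow> 0) at_top"
    using assms by real_asymp
  moreover have "((\<lambda>x. exp (ln x * (- b)) / (- b)) \<longlongrightarrow> 1 / (- b)) (at_right 1)"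
    using assms by (auto intro!: tendsto_eq_intros)
  ultimately show "set_integrable lborel {1<..} (\<lambda>x. exp (ln x * (- b)) / x)"
    using interval_integral_FTC_nonneg(1)[of "ereal 1" "\<infinity>" "\<lambda>x. exp (ln x * (- b)) / (- b)" "\<lambda>x. exp (ln x * (- b)) / x" "1/(-b)" 0] assms *[of _ "- b"] cont[of _ "- b"]
    by (auto simp: ereal_tendsto_simps intro!: continuous_intros)
qed

lemma set_integrable_norm_le:
  fixes f :: "real \<Rightarrow> complex" and g :: "real \<Rightarrow> real"
  assumes "set_integrable lborel A g" "A \<in> sets borel" and [measurable]: "f \<in> borel_measurable borel"
    and "\<And>x. x \<in> A \<Longrightarrow> norm (f x) \<le> g x"
  shows "set_integrable lborel A f"
  unfolding set_integrable_def
proof (rule Bochner_Integration.integrable_bound)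
  show "integrable lborel (\<lambda>x. indicator A x *\<^sub>R g x)"
    using assms(1) by (simp add: set_integrable_def)
  show "(\<lambda>x. indicator A x *\<^sub>R f x) \<in> borel_measurable lborel"
    using assms(2) by measurable
  show "AE x in lborel. norm (indicator A x *\<^sub>R f x) \<le> norm (indicator A x *\<^sub>R g x)"
    using assms(4) by (intro AE_I2) (auto simp: indicator_def intro: order_trans[OF _ abs_ge_self])
qed

lemma mellin_integral:
  assumes "b > 0"
  shows "set_integrable lborel {0<..<1} (\<lambda>x. exp (of_real (ln x) * Complex b s) / of_real x)"
    and "(LINT x:{0<..<1}|lborel. exp (of_real (ln x) * Complex b s) / of_real x) = 1 / Complex b s"
    and "set_integrable lborel {1<..} (\<lambda>x. exp (of_real (ln x) * Complex (- b) s) / of_real x)"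
    and "(LINT x:{1<..}|lborel. exp (of_real (ln x) * Complex (- b) s) / of_real x) = - 1 / Complex (- b) s"
proof -
  let ?w = "Complex b s" and ?v = "Complex (- b) s"
  have nz: "?w \<noteq> 0" "?v \<noteq> 0" using assms by (auto simp: complex_eq_iff)
  have cont: "isCont (\<lambda>x. exp (of_real (ln x) * w) / of_real x) x" if "x > 0" for x :: real and w :: complex
    using that by (auto intro!: continuous_intros)
  have norm: "norm (exp (of_real (ln x) * w) / of_real x) \<le> exp (ln x * Re w) / x" if "x > 0" for x w
    using that by (simp add: norm_divide)
  have limit: "((\<lambda>x. exp (of_real (ln x) * w) / w) \<longlongrightarrow> 0) F"
    if "((\<lambda>x. exp (ln x * Re w)) \<longlongrightarrow> 0) F" for w and F :: "real filter"
  proof -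
    have "((\<lambda>x. exp (of_real (ln x) * w)) \<longlongrightarrow> 0) F"
      by (rule tendsto_norm_zero_cancel) (use that in simp)
    then show ?thesis by (rule tendsto_divide_zero)
  qed
  show 1: "set_integrable lborel {0<..<1} (\<lambda>x. exp (of_real (ln x) * ?w) / of_real x)"
    by (rule set_integrable_norm_le[OF mellin_integrable(1)[OF assms]]) (use norm[of _ ?w] in auto)
  show 2: "set_integrable lborel {1<..} (\<lambda>x. exp (of_real (ln x) * ?v) / of_real x)"
    by (rule set_integrable_norm_le[OF mellin_integrable(2)[OF assms]]) (use norm[of _ ?v] in auto)
  have "((\<lambda>x. exp (of_real (ln x) * ?w) / ?w) \<longlongrightarrow> 0) (at_right 0)"
    by (rule limit) (use assms in \<open>simp, real_asymp\<close>)
  moreover have "((\<lambda>x. exp (of_real (ln x) * ?w) / ?w) \<longlongrightarrow> 1 / ?w) (at_left 1)"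
    using nz by (auto intro!: tendsto_eq_intros)
  ultimately show "(LINT x:{0<..<1}|lborel. exp (of_real (ln x) * ?w) / of_real x) = 1 / ?w"
    using interval_integral_FTC_integrable[of "ereal 0" "ereal 1" "\<lambda>x. exp (of_real (ln x) * ?w) / ?w"
        "\<lambda>x. exp (of_real (ln x) * ?w) / of_real x" 0 "1 / ?w"] 1 mellin_primitive[OF nz(1)] cont
    by (auto simp: ereal_tendsto_simps interval_lebesgue_integral_def intro!: continuous_intros)
  have "((\<lambda>x. exp (of_real (ln x) * ?v) / ?v) \<longlongrightarrow> 0) at_top"
    by (rule limit) (use assms in \<open>simp, real_asymp\<close>)
  moreover have "((\<lambda>x. exp (of_real (ln x) * ?v) / ?v) \<longlongrightarrow> 1 / ?v) (at_right 1)"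
    using nz by (auto intro!: tendsto_eq_intros)
  ultimately show "(LINT x:{1<..}|lborel. exp (of_real (ln x) * ?v) / of_real x) = - 1 / ?v"
    using interval_integral_FTC_integrable[of "ereal 1" "\<infinity>" "\<lambda>x. exp (of_real (ln x) * ?v) / ?v"
        "\<lambda>x. exp (of_real (ln x) * ?v) / of_real x" "1 / ?v" 0] 2 mellin_primitive[OF nz(2)] cont
    by (auto simp: ereal_tendsto_simps interval_lebesgue_integral_def intro!: continuous_intros)
qed

text \<open>
  These elementary Mellin integrals are the terms of every series below.  The part over
  \<open>\<nu> < 1\<close> gives \<open>1/(b+is)\<close> and the part over \<open>\<nu> > 1\<close> gives \<open>1/(b-is)\<close>.
\<close>

lemma character_moment:
  assumes "b > 0"
  shows "has_bochner_integral dstar (\<lambda>\<nu>. character s \<nu> * of_real (f0 \<nu> powr (2 * b)))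
     (inverse (Complex b s) + inverse (Complex b (- s)))"
proof -
  let ?f = "\<lambda>\<nu>. character s \<nu> * of_real (f0 \<nu> powr (2 * b))"
  have exp: "exp (of_real (ln \<nu>) * Complex c s) = character s \<nu> * of_real (exp (ln \<nu> * c))" for c \<nu>
    by (simp add: exp_eq_polar character_def mult.commute)
  have lt: "?f \<nu> / of_real \<nu> = exp (of_real (ln \<nu>) * Complex b s) / of_real \<nu>" if "\<nu> \<in> {0<..<1}" for \<nu>
    using that unfolding exp by (simp add: f0_exp powr_def mult.commute)
  have gt: "?f \<nu> / of_real \<nu> = exp (of_real (ln \<nu>) * Complex (- b) s) / of_real \<nu>" if "\<nu> \<in> {1<..}" for \<nu>
    using that unfolding exp by (simp add: f0_exp powr_def mult.commute)
  have "has_bochner_integral dstar ?f (1 / Complex b s + - 1 / Complex (- b) s)"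
  proof (rule has_bochner_integral_dstar)
    show "set_integrable lborel {0<..<1} (\<lambda>\<nu>. ?f \<nu> / of_real \<nu>)"
      using mellin_integral(1)[OF assms, of s] by (subst set_integrable_cong[OF refl refl lt])
    show "set_integrable lborel {1<..} (\<lambda>\<nu>. ?f \<nu> / of_real \<nu>)"
      using mellin_integral(3)[OF assms, of s] by (subst set_integrable_cong[OF refl refl gt])
    show "(LINT \<nu>:{0<..<1}|lborel. ?f \<nu> / of_real \<nu>) = 1 / Complex b s"
      using lt by (subst mellin_integral(2)[OF assms, symmetric], intro set_lebesgue_integral_cong) auto
    show "(LINT \<nu>:{1<..}|lborel. ?f \<nu> / of_real \<nu>) = - 1 / Complex (- b) s"
      using gt by (subst mellin_integral(4)[OF assms, symmetric], intro set_lebesgue_integral_cong) auto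
  qed measurable
  moreover have "Complex b (- s) = - Complex (- b) s" by (simp add: complex_eq_iff)
  then have "- 1 / Complex (- b) s = inverse (Complex b (- s))"
    by (simp only: inverse_minus_eq divide_inverse mult_minus_left mult_1_left)
  ultimately show ?thesis by (simp only: inverse_eq_divide)
qed

section \<open>The digamma function on vertical lines\<close>

lemma Digamma_diff_sums:
  fixes w z :: complex
  assumes "w \<noteq> 0" "z \<noteq> 0"
  shows "(\<lambda>k. inverse (w + of_nat k) - inverse (z + of_nat k)) sums (Digamma z - Digamma w)"
  unfolding sums_def sum_subtractf
  using tendsto_diff[OF Digamma_LIMSEQ[OF assms(2)] Digamma_LIMSEQ[OF assms(1)]] by simp

lemma Digamma_cnj: "z \<noteq> 0 \<Longrightarrow> Digamma (cnj z) = cnj (Digamma z)"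
proof (rule LIMSEQ_unique)
  assume z: "z \<noteq> 0"
  then show "(\<lambda>m. of_real (ln (real m)) - (\<Sum>n<m. inverse (cnj z + of_nat n))) \<longlonglongrightarrow> Digamma (cnj z)"
    by (intro Digamma_LIMSEQ) simp
  show "(\<lambda>m. of_real (ln (real m)) - (\<Sum>n<m. inverse (cnj z + of_nat n))) \<longlonglongrightarrow> cnj (Digamma z)"
    using tendsto_cnj[OF Digamma_LIMSEQ[OF z]] by (simp add: cnj_sum)
qed

text \<open>
  By the mean value theorem \<open>ln x = ln_Gamma (x + 1) - ln_Gamma x\<close> is a value of \<open>Digamma\<close>
  between \<open>x\<close> and \<open>x + 1\<close>, and \<open>Digamma\<close> is increasing.
\<close>

lemma Digamma_minus_ln_real_bounds:
  fixes x :: real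
  assumes "x > 0"
  shows "ln x - 1 / x \<le> Digamma x" "Digamma x \<le> ln x"
proof -
  have "\<exists>y>x. y < x + 1 \<and> ln_Gamma (x + 1) - ln_Gamma x = (x + 1 - x) * Digamma y"
    using assms by (intro MVT2) (auto intro!: derivative_eq_intros)
  then obtain y where y: "x < y" "y < x + 1" "ln_Gamma (x + 1) - ln_Gamma x = Digamma y" by auto
  have "ln_Gamma (x + 1) = ln x + ln_Gamma x"
  proof -
    have "Gamma (x + 1) = x * Gamma x"
      using assms by (intro Gamma_plus1) (auto elim!: nonpos_Ints_cases)
    moreover have "Gamma x \<noteq> 0" using Gamma_real_pos[OF assms] by linarith
    ultimately show ?thesis using assms by (simp add: ln_Gamma_real_pos ln_mult)
  qed
  then have "Digamma y = ln x" using y(3) by simp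
  moreover have "Digamma x \<le> Digamma y" "Digamma y \<le> Digamma (x + 1)"
    using assms y by (auto intro!: Digamma_real_mono)
  moreover have "Digamma (x + 1) = Digamma x + 1 / x"
    using assms by (intro Digamma_plus1) auto
  ultimately show "ln x - 1 / x \<le> Digamma x" "Digamma x \<le> ln x" by auto
qed

text \<open>
  The difference is a series whose \<open>k\<close>-th term is at most \<open>\<bar>s\<bar> / ((x+k) (x+k-1))\<close>, and this
  majorant telescopes.
\<close>

lemma Digamma_imaginary_shift:
  assumes "x > 1"
  shows "norm (Digamma (Complex x s) - Digamma (of_real x)) \<le> \<bar>s\<bar> / (x - 1)"
proof -
  let ?g = "\<lambda>k. inverse (complex_of_real x + of_nat k) - inverse (Complex x s + of_nat k)"
  have sums: "?g sums (Digamma (Complex x s) - Digamma (of_real x))"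
    using assms by (intro Digamma_diff_sums) (auto simp: complex_eq_iff)
  have tele: "(\<lambda>k. \<bar>s\<bar> * (inverse (x - 1 + real k) - inverse (x - 1 + real (Suc k)))) sums (\<bar>s\<bar> * (inverse (x - 1 + real 0) - 0))"
  proof (intro sums_mult telescope_sums')
    show "(\<lambda>k. inverse (x - 1 + real k)) \<longlonglongrightarrow> 0" by real_asymp
  qed
  have le: "norm (?g k) \<le> \<bar>s\<bar> * (inverse (x - 1 + real k) - inverse (x - 1 + real (Suc k)))" for k
  proof -
    let ?y = "x + real k"
    have y: "?y > 1" using assms by simp
    have eq: "complex_of_real x + of_nat k = of_real ?y" "Complex x s + of_nat k = Complex ?y s"
      by (auto simp: complex_eq_iff)
    have nz: "complex_of_real ?y \<noteq> 0" "Complex ?y s \<noteq> 0" using y by (auto simp: complex_eq_iff)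
    have "?g k = (Complex ?y s - of_real ?y) * inverse (of_real ?y) * inverse (Complex ?y s)"
      unfolding eq using nz by (simp add: field_simps)
    also have "Complex ?y s - of_real ?y = \<i> * of_real s"
      by (simp add: complex_eq_iff)
    finally have "norm (?g k) = norm (\<i> * of_real s * inverse (complex_of_real ?y) * inverse (Complex ?y s))"
      by simp
    also have "\<dots> = \<bar>s\<bar> * (inverse ?y * inverse (norm (Complex ?y s)))"
    proof -
      have "\<bar>?y\<bar> = ?y" using y by simp
      then show ?thesis
        by (simp only: norm_mult norm_inverse norm_ii norm_of_real mult_1_left mult.assoc)
    qed
    also have "\<dots> \<le> \<bar>s\<bar> * (inverse ?y * inverse (?y - 1))"
    proof (intro mult_left_mono le_imp_inverse_le)
      have "\<bar>Re (Complex ?y s)\<bar> \<le> norm (Complex ?y s)" by (rule abs_Re_le_cmod)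
      then show "?y - 1 \<le> norm (Complex ?y s)" by simp
    qed (use y in auto)
    also have "inverse ?y * inverse (?y - 1) = inverse (x - 1 + real k) - inverse (x - 1 + real (Suc k))"
    proof -
      have "x - 1 + real k = ?y - 1" "x - 1 + real (Suc k) = ?y" by auto
      then show ?thesis using y by (simp add: field_simps)
    qed
    finally show ?thesis .
  qed
  have "norm (suminf ?g) \<le> (\<Sum>k. \<bar>s\<bar> * (inverse (x - 1 + real k) - inverse (x - 1 + real (Suc k))))"
    by (intro norm_suminf_le le sums_summable[OF tele])
  then show ?thesis
    using sums_unique[OF sums] sums_unique[OF tele] by (simp add: divide_inverse)
qed

lemma Digamma_asymp:
  "((\<lambda>x. Digamma (Complex x s) - of_real (ln x)) \<longlongrightarrow> 0) at_top"
proof (rule tendsto_norm_zero_cancel, rule tendsto_sandwich[where f = "\<lambda>_. 0"])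
  show "((\<lambda>x. \<bar>s\<bar> / (x - 1) + 1 / x) \<longlongrightarrow> 0) at_top" by real_asymp
  show "\<forall>\<^sub>F x in at_top. norm (Digamma (Complex x s) - of_real (ln x)) \<le> \<bar>s\<bar> / (x - 1) + 1 / x"
    using eventually_gt_at_top[of 1]
  proof eventually_elim
    case (elim x)
    have "norm (Digamma (complex_of_real x) - of_real (ln x)) = \<bar>Digamma x - ln x\<bar>"
      using elim by (simp add: Polygamma_of_real flip: of_real_diff)
    also have "\<dots> \<le> 1 / x" using Digamma_minus_ln_real_bounds[of x] elim by auto
    finally have 1: "norm (Digamma (complex_of_real x) - of_real (ln x)) \<le> 1 / x" .
    show ?case
      using norm_triangle_ineq[of "Digamma (Complex x s) - Digamma (of_real x)" "Digamma (of_real x) - of_real (ln x)"]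
        Digamma_imaginary_shift[OF elim, of s] 1 by simp
  qed
qed auto

lemma Digamma_shift_asymp:
  "((\<lambda>t. Digamma (Complex (a + t) s) - of_real (ln t)) \<longlongrightarrow> 0) at_top"
proof -
  have "filterlim (\<lambda>t. a + t) at_top at_top" by real_asymp
  then have "((\<lambda>t. Digamma (Complex (a + t) s) - of_real (ln (a + t))) \<longlongrightarrow> 0) at_top"
    by (rule filterlim_compose[OF Digamma_asymp])
  moreover have "((\<lambda>t. complex_of_real (ln (a + t) - ln t)) \<longlongrightarrow> of_real 0) at_top"
    by (intro tendsto_of_real) real_asymp
  ultimately show ?thesis using tendsto_add by fastforce
qed

section \<open>The regularised Mellin integral\<close>

text \<open>
  \<open>1 / f1 = f0 / (1 - f0\<^sup>2)\<close> is a geometric series.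
\<close>

lemma inverse_f1_sums:
  assumes "\<nu> > 0" "\<nu> \<noteq> 1"
  shows "(\<lambda>k. f0 \<nu> powr (1 + 2 * real k)) sums inverse (f1 \<nu>)"
proof -
  let ?y = "f0 \<nu>"
  have y: "0 < ?y" "?y < 1" using f0_pos f0_less_1 assms by auto
  then have y2: "?y\<^sup>2 < 1" by (simp add: power_less_one_iff)
  have "(\<lambda>k. ?y * (?y\<^sup>2) ^ k) sums (?y * (1 / (1 - ?y\<^sup>2)))"
    using y y2 by (intro sums_mult geometric_sums) auto
  moreover have "?y * (?y\<^sup>2) ^ k = ?y powr (1 + 2 * real k)" for k
    using y powr_realpow[of ?y "2 * k"] by (simp add: powr_add power_mult)
  moreover have "?y * (1 / (1 - ?y\<^sup>2)) = inverse (f1 \<nu>)"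
  proof -
    have "f1 \<nu> = (1 - ?y\<^sup>2) / ?y" using y by (simp add: f1_def field_simps power2_eq_square)
    then show ?thesis by simp
  qed
  ultimately show ?thesis by simp
qed

text \<open>
  The fibre integral of the trace integrand for a Hodge type \<open>(p, q)\<close> with Hodge number \<open>1\<close>, where \<open>n\<close> stands for
  \<open>\<bar>p - q\<bar>\<close>.
\<close>

definition mellin_term :: "nat \<Rightarrow> real \<Rightarrow> real \<Rightarrow> complex" where
  "mellin_term n s \<nu> = character s \<nu> * of_real (f0 \<nu> ^ n * inverse (f1 \<nu>))"

lemma mellin_term_measurable [measurable]: "mellin_term n s \<in> borel_measurable borel"
  unfolding mellin_term_def by measurable

text \<open>
  The factor \<open>1 - f0\<^sup>2\<^sup>t\<close> removes the singularity at \<open>\<nu> = 1\<close>, so that the geometric series can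
  be integrated term by term.  For \<open>s = 0\<close> the terms are nonnegative, and they are the norms of the
  terms for general \<open>s\<close>; hence the series for \<open>s = 0\<close> supplies the summability of the norms.
\<close>

lemma cutoff_integral:
  fixes n :: nat and s t :: real
  assumes "t > 0"
  defines "a \<equiv> (1 + real n) / 2"
  shows "has_bochner_integral dstar (\<lambda>\<nu>. of_real (1 - f0 \<nu> powr (2 * t)) * mellin_term n s \<nu>)
     ((Digamma (Complex (a + t) s) - Digamma (Complex a s))
        + (Digamma (Complex (a + t) (- s)) - Digamma (Complex a (- s))))"
proof -
  define g where "g s k \<nu> = character s \<nu> * of_real (f0 \<nu> powr (2 * (a + real k)))
      - character s \<nu> * of_real (f0 \<nu> powr (2 * (a + t + real k)))" for s k \<nu>
  define J where "J s k = (inverse (Complex (a + real k) s) + inverse (Complex (a + real k) (- s)))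
      - (inverse (Complex (a + t + real k) s) + inverse (Complex (a + t + real k) (- s)))" for s k
  have a: "a > 0" by (simp add: a_def)
  have g_int: "has_bochner_integral dstar (g s k) (J s k)" for s k
    unfolding g_def J_def using a assms(1)
    by (intro has_bochner_integral_diff character_moment) auto
  have J_sums: "J s sums ((Digamma (Complex (a + t) s) - Digamma (Complex a s))
        + (Digamma (Complex (a + t) (- s)) - Digamma (Complex a (- s))))" for s
  proof -
    have shift: "Complex (x + real k) y = Complex x y + of_nat k" for x y k by (simp add: complex_eq_iff)
    have "J s = (\<lambda>k. (inverse (Complex a s + of_nat k) - inverse (Complex (a + t) s + of_nat k))
        + (inverse (Complex a (- s) + of_nat k) - inverse (Complex (a + t) (- s) + of_nat k)))"
      unfolding J_def shift by (simp add: fun_eq_iff)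
    moreover have "(\<lambda>k. (inverse (Complex a s + of_nat k) - inverse (Complex (a + t) s + of_nat k))
        + (inverse (Complex a (- s) + of_nat k) - inverse (Complex (a + t) (- s) + of_nat k)))
      sums ((Digamma (Complex (a + t) s) - Digamma (Complex a s))
        + (Digamma (Complex (a + t) (- s)) - Digamma (Complex a (- s))))"
      using a assms(1) by (intro sums_add Digamma_diff_sums) (auto simp: complex_eq_iff)
    ultimately show ?thesis by simp
  qed
  have g_0: "complex_of_real (norm (g s k \<nu>)) = g 0 k \<nu>" if "\<nu> > 0" "\<nu> \<noteq> 1" for k \<nu>
  proof -
    let ?d = "f0 \<nu> powr (2 * (a + real k)) - f0 \<nu> powr (2 * (a + t + real k))"
    have g: "g s k \<nu> = character s \<nu> * of_real ?d" for s
      unfolding g_def of_real_diff right_diff_distrib ..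
    have "f0 \<nu> powr (2 * (a + t + real k)) \<le> f0 \<nu> powr (2 * (a + real k))"
      using that assms f0_pos[of \<nu>] f0_less_1[of \<nu>] by (intro powr_mono') auto
    then have "\<bar>?d\<bar> = ?d" by linarith
    then show ?thesis unfolding g norm_mult norm_of_real by simp
  qed
  have norm_int: "complex_of_real (\<integral>\<nu>. norm (g s k \<nu>) \<partial>dstar) = J 0 k" for k
  proof -
    have "complex_of_real (\<integral>\<nu>. norm (g s k \<nu>) \<partial>dstar) = (\<integral>\<nu>. complex_of_real (norm (g s k \<nu>)) \<partial>dstar)"
      by simp
    also have "\<dots> = (\<integral>\<nu>. g 0 k \<nu> \<partial>dstar)"
    proof (rule integral_cong_AE)
      show "AE \<nu> in dstar. complex_of_real (norm (g s k \<nu>)) = g 0 k \<nu>"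
        using AE_dstar by eventually_elim (use g_0 in blast)
    qed (auto simp: g_def intro!: measurable_dstar)
    finally show ?thesis using g_int[of 0 k] by (simp add: has_bochner_integral_iff)
  qed
  have summ: "summable (\<lambda>k. \<integral>\<nu>. norm (g s k \<nu>) \<partial>dstar)"
    using sums_summable[OF J_sums[of 0]] unfolding norm_int[symmetric] by (rule summable_of_real_iff[THEN iffD1])
  have g_sums: "(\<lambda>k. g s k \<nu>) sums (of_real (1 - f0 \<nu> powr (2 * t)) * mellin_term n s \<nu>)"
    if "\<nu> > 0" "\<nu> \<noteq> 1" for s \<nu>
  proof -
    let ?y = "f0 \<nu>"
    have y: "?y > 0" using f0_pos that by auto
    have g: "g s k \<nu> = character s \<nu> * of_real ((1 - ?y powr (2 * t)) * ?y ^ n * ?y powr (1 + 2 * real k))" for k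
    proof -
      have "2 * (a + real k) = real n + (1 + 2 * real k)"
        "2 * (a + t + real k) = 2 * t + (real n + (1 + 2 * real k))"
        by (auto simp: a_def field_simps)
      then show ?thesis
        unfolding g_def using y by (simp only: powr_add powr_realpow of_real_diff of_real_mult of_real_1) (simp add: algebra_simps)
    qed
    have "(\<lambda>k. character s \<nu> * of_real ((1 - ?y powr (2 * t)) * ?y ^ n * ?y powr (1 + 2 * real k)))
        sums (character s \<nu> * of_real ((1 - ?y powr (2 * t)) * ?y ^ n * inverse (f1 \<nu>)))"
      by (intro sums_mult sums_of_real inverse_f1_sums that)
    then have "(\<lambda>k. g s k \<nu>) sums (character s \<nu> * of_real ((1 - ?y powr (2 * t)) * ?y ^ n * inverse (f1 \<nu>)))"
      unfolding g .
    moreover have "character s \<nu> * of_real ((1 - ?y powr (2 * t)) * ?y ^ n * inverse (f1 \<nu>))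
        = of_real (1 - ?y powr (2 * t)) * mellin_term n s \<nu>"
      by (simp add: mellin_term_def)
    ultimately show ?thesis by (simp only:)
  qed
  have "AE \<nu> in dstar. summable (\<lambda>k. norm (g s k \<nu>))"
    using AE_dstar
  proof eventually_elim
    case (elim \<nu>)
    then have "summable (\<lambda>k. complex_of_real (norm (g s k \<nu>)))"
      using sums_summable[OF g_sums[of \<nu> 0]] by (simp add: g_0)
    then show ?case by (rule summable_of_real_iff[THEN iffD1])
  qed
  \<comment> \<open>dominated termwise integration, justified by the case \<open>s = 0\<close>\<close>
  note series = integrable_suminf[OF _ this summ] integral_suminf[OF _ this summ]
  have total: "has_bochner_integral dstar (\<lambda>\<nu>. \<Sum>k. g s k \<nu>) (\<Sum>k. J s k)"
    using g_int[of s] series by (simp add: has_bochner_integral_iff)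
  have sum_eq: "AE \<nu> in dstar. (\<Sum>k. g s k \<nu>) = of_real (1 - f0 \<nu> powr (2 * t)) * mellin_term n s \<nu>"
    using AE_dstar by eventually_elim (metis g_sums sums_unique)
  have "has_bochner_integral dstar (\<lambda>\<nu>. of_real (1 - f0 \<nu> powr (2 * t)) * mellin_term n s \<nu>) (\<Sum>k. J s k)"
    by (rule has_bochner_integral_cong_AE[THEN iffD1, OF _ _ sum_eq total])
      (auto intro!: measurable_dstar simp: g_def)
  then show ?thesis
    unfolding sums_unique[OF J_sums[of s], symmetric] .
qed

lemma norm_character_minus_1: "norm (character s \<nu> - 1) \<le> \<bar>s\<bar> * \<bar>ln \<nu>\<bar>"
proof -
  have "norm (character s \<nu> - 1) = 2 * \<bar>sin (s * ln \<nu> / 2)\<bar>"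
    using dist_exp_i_1[of "s * ln \<nu>"] by (simp add: character_def cis_conv_exp)
  also have "\<dots> \<le> 2 * \<bar>s * ln \<nu> / 2\<bar>" by (intro mult_left_mono abs_sin_x_le_abs_x) auto
  finally show ?thesis by (simp add: abs_mult)
qed

text \<open>
  The zero of \<open>ln \<nu>\<close> at \<open>1\<close> cancels the pole of \<open>1 / f1\<close>, and what remains decays like a power
  of \<open>f0\<close> in both directions.  The exponent \<open>1/2\<close> leaves room to absorb the linear growth of
  \<open>\<bar>ln \<nu>\<bar>\<close> into an exponential.
\<close>

lemma ln_le_f1_mult:
  assumes "\<nu> > 0"
  shows "\<bar>ln \<nu>\<bar> * inverse (f1 \<nu>) \<le> 4 * f0 \<nu> powr (1/2)"
proof (cases "\<nu> = 1")
  case False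
  define x where "x = \<bar>ln \<nu>\<bar>"
  have x: "x > 0" using assms False by (simp add: x_def)
  have f0: "f0 \<nu> = exp (- x / 2)" using assms by (simp add: f0_exp x_def)
  \<comment> \<open>equivalent to \<open>1 + x \<le> exp x\<close>\<close>
  have "x \<le> (1 + x) * (1 - exp (- x))"
    using exp_ge_add_one_self[of x] x by (simp add: exp_minus field_simps)
  also have "\<dots> \<le> 4 * exp (x / 4) * (1 - exp (- x))"
  proof (rule mult_right_mono)
    show "1 + x \<le> 4 * exp (x / 4)" using exp_ge_add_one_self[of "x / 4"] by linarith
  qed (use x in auto)
  also have "\<dots> = 4 * exp (- x / 4) * f1 \<nu>"
    by (simp add: f1_def f0 algebra_simps exp_minus[symmetric] flip: exp_add)
  finally have "x \<le> 4 * exp (- x / 4) * f1 \<nu>" .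
  moreover have "f1 \<nu> > 0" using x by (simp add: f1_def f0 flip: exp_minus)
  ultimately show ?thesis by (simp add: f0 powr_def field_simps flip: x_def)
qed (simp add: f1_def f0_exp)

text \<open>
  Near \<open>\<nu> = 1\<close> the numerator \<open>\<nu>\<^sup>i\<^sup>s f0\<^sup>n - 1\<close> is at most a constant times \<open>\<bar>ln \<nu>\<bar>\<close>,
  so the two terms have the same non-integrable part.
\<close>

lemma mellin_term_minus_inverse_f1_integrable:
  "integrable dstar (\<lambda>\<nu>. mellin_term n s \<nu> - of_real (inverse (f1 \<nu>)))"
proof (rule Bochner_Integration.integrable_bound)
  let ?K = "\<bar>s\<bar> + real n / 2"
  have "integrable dstar (\<lambda>\<nu>. character 0 \<nu> * of_real (f0 \<nu> powr (2 * (1/4))))"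
    using character_moment[of "1/4" 0] by (simp add: has_bochner_integral_iff)
  then show "integrable dstar (\<lambda>\<nu>. of_real (4 * ?K) * (character 0 \<nu> * of_real (f0 \<nu> powr (2 * (1/4)))))"
    by (rule integrable_mult_right)
  show "(\<lambda>\<nu>. mellin_term n s \<nu> - of_real (inverse (f1 \<nu>))) \<in> borel_measurable dstar"
    by (intro measurable_dstar) measurable
  show "AE \<nu> in dstar. norm (mellin_term n s \<nu> - of_real (inverse (f1 \<nu>)))
      \<le> norm (of_real (4 * ?K) * (character 0 \<nu> * of_real (f0 \<nu> powr (2 * (1/4)))))"
    using AE_dstar
  proof eventually_elim
    case (elim \<nu>)
    let ?L = "\<bar>ln \<nu>\<bar>"
    have y: "0 < f0 \<nu>" "f0 \<nu> < 1" using elim f0_pos f0_less_1 by auto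
    then have f1: "f1 \<nu> > 0" unfolding f1_def using one_less_inverse by fastforce
    have "f0 \<nu> ^ n = exp (- (real n / 2 * ?L))"
      using elim by (simp add: f0_exp flip: exp_of_nat_mult)
    then have "1 - f0 \<nu> ^ n \<le> real n / 2 * ?L"
      using exp_ge_add_one_self[of "- (real n / 2 * ?L)"] by simp
    moreover have "f0 \<nu> ^ n \<le> 1" using y by (simp add: power_le_one)
    ultimately have pow: "norm (complex_of_real (f0 \<nu> ^ n - 1)) \<le> real n / 2 * ?L"
      unfolding norm_of_real by simp
    have "norm (character s \<nu> * of_real (f0 \<nu> ^ n) - 1)
        = norm (character s \<nu> * of_real (f0 \<nu> ^ n - 1) + (character s \<nu> - 1))"
      by (simp add: algebra_simps)
    also have "\<dots> \<le> norm (character s \<nu> * of_real (f0 \<nu> ^ n - 1)) + norm (character s \<nu> - 1)"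
      by (rule norm_triangle_ineq)
    also have "\<dots> \<le> real n / 2 * ?L + \<bar>s\<bar> * ?L"
      using pow norm_character_minus_1[of s \<nu>] by (simp add: norm_mult)
    finally have "norm (character s \<nu> * of_real (f0 \<nu> ^ n) - 1) \<le> ?K * ?L"
      by (simp add: algebra_simps)
    then have "norm (character s \<nu> * of_real (f0 \<nu> ^ n) - 1) * inverse (f1 \<nu>) \<le> ?K * ?L * inverse (f1 \<nu>)"
      using f1 by (intro mult_right_mono) auto
    also have "\<dots> = ?K * (?L * inverse (f1 \<nu>))" by (rule mult.assoc)
    also have "\<dots> \<le> ?K * (4 * f0 \<nu> powr (1/2))"
      using elim by (intro mult_left_mono ln_le_f1_mult) auto
    finally have le: "norm (character s \<nu> * of_real (f0 \<nu> ^ n) - 1) * inverse (f1 \<nu>) \<le> ?K * (4 * f0 \<nu> powr (1/2))" .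
    have "mellin_term n s \<nu> - of_real (inverse (f1 \<nu>))
        = (character s \<nu> * of_real (f0 \<nu> ^ n) - 1) * of_real (inverse (f1 \<nu>))"
      by (simp add: mellin_term_def algebra_simps)
    then have "norm (mellin_term n s \<nu> - of_real (inverse (f1 \<nu>)))
        = norm (character s \<nu> * of_real (f0 \<nu> ^ n) - 1) * inverse (f1 \<nu>)"
      using f1 by (simp only: norm_mult norm_of_real abs_of_pos positive_imp_inverse_positive)
    also note le
    also have "?K * (4 * f0 \<nu> powr (1/2))
        = norm (complex_of_real (4 * ?K) * (character 0 \<nu> * of_real (f0 \<nu> powr (2 * (1/4)))))"
      by (simp only: norm_mult norm_character norm_of_real) (simp add: algebra_simps)
    finally show ?case .
  qed
qed

text \<open>
  The values of \<open>Digamma\<close> at \<open>a + is\<close> and \<open>a - is\<close> are conjugate, so only a real part survives.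
\<close>

lemma cutoff_integral_limit:
  fixes n :: nat and s :: real
  defines "a \<equiv> (1 + real n) / 2"
  shows "((\<lambda>t. (LINT \<nu>|dstar. of_real (1 - f0 \<nu> powr (2 * t)) * mellin_term n s \<nu>) - 2 * of_real (ln t))
     \<longlongrightarrow> - 2 * of_real (Re (Digamma (Complex a s)))) at_top"
proof (rule Lim_transform_eventually)
  let ?D = "Digamma (Complex a s) + Digamma (Complex a (- s))"
  have "((\<lambda>t. (Digamma (Complex (a + t) s) - of_real (ln t)) + (Digamma (Complex (a + t) (- s)) - of_real (ln t)) - ?D)
      \<longlongrightarrow> 0 + 0 - ?D) at_top"
    by (intro tendsto_intros Digamma_shift_asymp)
  also have "0 + 0 - ?D = - 2 * of_real (Re (Digamma (Complex a s)))"
  proof -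
    have "Complex a s \<noteq> 0" by (simp add: a_def complex_eq_iff)
    then have "Digamma (Complex a (- s)) = cnj (Digamma (Complex a s))"
      using Digamma_cnj[of "Complex a s"] by (simp add: complex_cnj)
    then show ?thesis by (simp add: complex_add_cnj)
  qed
  finally show "((\<lambda>t. (Digamma (Complex (a + t) s) - of_real (ln t)) + (Digamma (Complex (a + t) (- s)) - of_real (ln t)) - ?D)
      \<longlongrightarrow> - 2 * of_real (Re (Digamma (Complex a s)))) at_top" .
  show "\<forall>\<^sub>F t in at_top. (Digamma (Complex (a + t) s) - of_real (ln t)) + (Digamma (Complex (a + t) (- s)) - of_real (ln t)) - ?D
      = (LINT \<nu>|dstar. of_real (1 - f0 \<nu> powr (2 * t)) * mellin_term n s \<nu>) - 2 * of_real (ln t)"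
    using eventually_gt_at_top[of 0]
  proof eventually_elim
    case (elim t)
    show ?case
      using cutoff_integral[OF elim, of n s] unfolding a_def by (simp add: has_bochner_integral_iff)
  qed
qed

section \<open>Fibre coordinates on the critical line\<close>

lemma mod_C_eq: "mod_C u = (norm u)\<^sup>2"
  by (simp add: mod_C_def complex_mult_cnj cmod_power2)

lemma f0_sqrt: "\<nu> > 0 \<Longrightarrow> f0 \<nu> = min (sqrt \<nu>) (1 / sqrt \<nu>)"
  by (simp add: f0_def powr_half_sqrt powr_minus_divide)

lemma inverse_f1_sqrt:
  assumes "\<nu> > 0" "\<nu> \<noteq> 1"
  shows "inverse (f1 \<nu>) = sqrt \<nu> / \<bar>1 - \<nu>\<bar>"
proof -
  define r where "r = sqrt \<nu>"
  have r: "r > 0" "\<nu> = r\<^sup>2" "r \<noteq> 1" using assms by (auto simp: r_def)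
  have f0: "f0 \<nu> = min r (1 / r)" using f0_sqrt[OF assms(1)] by (simp add: r_def)
  have "f1 \<nu> = \<bar>1 - r\<^sup>2\<bar> / r"
  proof (cases "r < 1")
    case True
    then have "r * r < 1" using r mult_strict_mono[of r 1 r 1] by simp
    then show ?thesis unfolding f1_def f0 using r(1) True
      by (simp add: min_def field_simps power2_eq_square)
  next
    case False
    then have "1 < r * r" using r less_1_mult[of r r] by simp
    then show ?thesis unfolding f1_def f0 using r(1) False
      by (simp add: min_def field_simps power2_eq_square)
  qed
  then show ?thesis using r by (simp flip: r_def)
qed

text \<open>
  On the critical line \<open>\<nu>\<^sup>z\<close> exceeds \<open>\<nu>\<^sup>m\<^sup>/\<^sup>2\<close>, the inverse of the absolute value of
  \<open>u\<^sup>-\<^sup>p (cnj u)\<^sup>-\<^sup>q\<close>, by just the one factor \<open>sqrt \<nu>\<close> that turns \<open>1 / \<bar>1 - \<nu>\<bar>\<close> into \<open>1 / f1\<close>.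
\<close>

lemma of_real_powr_critical_point:
  assumes "\<nu> > 0"
  shows "of_real \<nu> powr critical_point m s = character s \<nu> * of_real (sqrt \<nu> ^ Suc m)"
proof -
  have "sqrt \<nu> = exp (ln \<nu> / 2)" using assms by (simp add: ln_sqrt[symmetric])
  then have "sqrt \<nu> ^ Suc m = exp (real (Suc m) * (ln \<nu> / 2))"
    by (simp only: exp_of_nat_mult)
  also have "real (Suc m) * (ln \<nu> / 2) = (1 + real m) / 2 * ln \<nu>" by (simp add: field_simps)
  finally have "complex_of_real (sqrt \<nu> ^ Suc m) = exp (of_real ((1 + real m) / 2 * ln \<nu>))"
    by (simp only: exp_of_real)
  moreover have "of_real \<nu> powr critical_point m s = exp (\<i> * of_real (s * ln \<nu>) + of_real ((1 + real m) / 2 * ln \<nu>))"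
    using assms by (simp add: powr_def critical_point_def Ln_of_real algebra_simps)
  ultimately show ?thesis by (simp only: exp_add character_def cis_conv_exp)
qed

lemma hodge_character_polar:
  assumes "r > 0" "p + q = m"
  shows "(of_real r * cis \<theta>) powi (- int p) * cnj (of_real r * cis \<theta>) powi (- int q)
     = of_real (inverse (r ^ m)) * cis (of_int (int q - int p) * \<theta>)"
proof -
  have "(of_real r * cis \<theta>) powi (- int p) = of_real (inverse (r ^ p)) * cis (- (real p * \<theta>))"
    by (simp add: power_int_minus power_mult_distrib Complex.DeMoivre)
  moreover have "cnj (of_real r * cis \<theta>) powi (- int q) = of_real (inverse (r ^ q)) * cis (real q * \<theta>)"
    by (simp add: power_int_minus power_mult_distrib Complex.DeMoivre cis_cnj)
  ultimately have "(of_real r * cis \<theta>) powi (- int p) * cnj (of_real r * cis \<theta>) powi (- int q)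
      = of_real (inverse (r ^ p) * inverse (r ^ q)) * (cis (- (real p * \<theta>)) * cis (real q * \<theta>))"
    by (simp only: of_real_mult mult_ac)
  also have "inverse (r ^ p) * inverse (r ^ q) = inverse (r ^ m)"
    using assms by (simp add: power_add flip: assms(2))
  also have "cis (- (real p * \<theta>)) * cis (real q * \<theta>) = cis (of_int (int q - int p) * \<theta>)"
    by (simp add: cis_mult algebra_simps)
  finally show ?thesis .
qed

section \<open>Principal values of sums of Mellin terms\<close>

text \<open>
  The Borel sigma-algebra is not complete, so agreement almost everywhere would not transfer measurability;
  here the only exceptional point of the space is \<open>1\<close>.
\<close>

lemma measurable_dstar_cong:
  fixes f g :: "real \<Rightarrow> complex"
  assumes eq: "\<And>\<nu>. \<nu> > 0 \<Longrightarrow> \<nu> \<noteq> 1 \<Longrightarrow> f \<nu> = g \<nu>" and [measurable]: "g \<in> borel_measurable borel"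
  shows "f \<in> borel_measurable dstar"
proof -
  have "(\<lambda>\<nu>. if \<nu> = 1 then f 1 else g \<nu>) \<in> borel_measurable dstar"
    by (intro measurable_dstar) measurable
  moreover have "f \<nu> = (if \<nu> = 1 then f 1 else g \<nu>)" if "\<nu> \<in> space dstar" for \<nu>
    using that eq by (auto simp: dstar_def space_restrict_space)
  ultimately show ?thesis by (subst measurable_cong) auto
qed

text \<open>
  Each \<open>mellin_term\<close> has residue \<open>1\<close> against \<open>1 / f1\<close>, so the constant of the principal value is the
  sum of the coefficients.
\<close>

lemma has_pv_integral_mellin:
  fixes c :: "'i \<Rightarrow> complex" and n :: "'i \<Rightarrow> nat"
  assumes I: "finite I"
    and fibre: "\<And>\<nu>. \<nu> > 0 \<Longrightarrow> \<nu> \<noteq> 1 \<Longrightarrow>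
      has_bochner_integral (fibre_measure \<nu>) \<phi> (\<Sum>i\<in>I. c i * mellin_term (n i) s \<nu>)"
  shows "has_pv_integral \<phi>
    (\<Sum>i\<in>I. c i * of_real (2 * ln (2 * pi) - 2 * Re (Digamma (Complex ((1 + real (n i)) / 2) s))))"
proof -
  let ?\<psi> = "\<lambda>\<nu>. \<Sum>i\<in>I. c i * mellin_term (n i) s \<nu>" and ?c = "\<Sum>i\<in>I. c i"
  have fi: "fibre_integral \<phi> \<nu> = ?\<psi> \<nu>" if "\<nu> > 0" "\<nu> \<noteq> 1" for \<nu>
    using fibre[OF that] by (simp add: fibre_integral_def has_bochner_integral_iff)
  have fi_AE: "AE \<nu> in dstar. fibre_integral \<phi> \<nu> = ?\<psi> \<nu>"
    using AE_dstar by eventually_elim (use fi in blast)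
  have fi_meas: "fibre_integral \<phi> \<in> borel_measurable dstar"
    by (rule measurable_dstar_cong[OF fi]) auto
  have f0_meas [measurable]: "f0 \<in> borel_measurable dstar" "f1 \<in> borel_measurable dstar" 
    "mellin_term k s \<in> borel_measurable dstar" for k
    by (intro measurable_dstar; measurable)+
  note [measurable] = fi_meas
  have 1: "AE \<nu> in dstar. integrable (fibre_measure \<nu>) \<phi>"
    using AE_dstar by eventually_elim (use fibre in \<open>auto simp: has_bochner_integral_iff\<close>)
  have "integrable dstar (\<lambda>\<nu>. \<Sum>i\<in>I. c i * (mellin_term (n i) s \<nu> - of_real (inverse (f1 \<nu>))))"
    by (intro Bochner_Integration.integrable_sum integrable_mult_right mellin_term_minus_inverse_f1_integrable)
  then have 2: "integrable dstar (\<lambda>\<nu>. fibre_integral \<phi> \<nu> - ?c * of_real (inverse (f1 \<nu>)))"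
  proof (rule integrable_cong_AE_imp)
    show "AE \<nu> in dstar. (\<Sum>i\<in>I. c i * (mellin_term (n i) s \<nu> - of_real (inverse (f1 \<nu>))))
        = fibre_integral \<phi> \<nu> - ?c * of_real (inverse (f1 \<nu>))"
      using fi_AE by eventually_elim (simp add: right_diff_distrib sum_subtractf sum_distrib_right)
  qed measurable
  let ?l = "\<Sum>i\<in>I. c i * (- 2 * of_real (Re (Digamma (Complex ((1 + real (n i)) / 2) s))))"
  have "((\<lambda>t. \<Sum>i\<in>I. c i * ((LINT \<nu>|dstar. of_real (1 - f0 \<nu> powr (2 * t)) * mellin_term (n i) s \<nu>)
      - 2 * of_real (ln t))) \<longlongrightarrow> ?l) at_top"
    by (intro tendsto_sum tendsto_mult tendsto_const cutoff_integral_limit)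
  then have 3: "((\<lambda>t. (LINT \<nu>|dstar. of_real (1 - f0 \<nu> powr (2 * t)) * fibre_integral \<phi> \<nu>)
      - 2 * ?c * of_real (ln t)) \<longlongrightarrow> ?l) at_top"
  proof (rule Lim_transform_eventually)
    show "\<forall>\<^sub>F t in at_top. (\<Sum>i\<in>I. c i * ((LINT \<nu>|dstar. of_real (1 - f0 \<nu> powr (2 * t)) * mellin_term (n i) s \<nu>)
        - 2 * of_real (ln t)))
      = (LINT \<nu>|dstar. of_real (1 - f0 \<nu> powr (2 * t)) * fibre_integral \<phi> \<nu>) - 2 * ?c * of_real (ln t)"
      using eventually_gt_at_top[of 0]
    proof eventually_elim
      case (elim t)
      let ?g = "\<lambda>i \<nu>. of_real (1 - f0 \<nu> powr (2 * t)) * mellin_term (n i) s \<nu>"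
      have "(LINT \<nu>|dstar. of_real (1 - f0 \<nu> powr (2 * t)) * fibre_integral \<phi> \<nu>)
          = (LINT \<nu>|dstar. (\<Sum>i\<in>I. c i * ?g i \<nu>))"
      proof (rule integral_cong_AE)
        show "AE \<nu> in dstar. of_real (1 - f0 \<nu> powr (2 * t)) * fibre_integral \<phi> \<nu> = (\<Sum>i\<in>I. c i * ?g i \<nu>)"
          using fi_AE by eventually_elim (simp add: sum_distrib_left mult.left_commute)
      qed measurable
      also have "\<dots> = (\<Sum>i\<in>I. LINT \<nu>|dstar. c i * ?g i \<nu>)"
        using cutoff_integral[OF elim] by (intro Bochner_Integration.integral_sum integrable_mult_right) (auto simp: has_bochner_integral_iff)
      also have "\<dots> = (\<Sum>i\<in>I. c i * (LINT \<nu>|dstar. ?g i \<nu>))"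
        by (simp only: integral_mult_right_zero)
      finally show ?case
        by (simp add: right_diff_distrib[of "c _"] sum_subtractf sum_distrib_left sum_distrib_right mult_ac)
    qed
  qed
  have "(\<Sum>i\<in>I. c i * of_real (2 * ln (2 * pi) - 2 * Re (Digamma (Complex ((1 + real (n i)) / 2) s))))
      = 2 * of_real (ln (2 * pi)) * ?c + ?l"
    by (simp add: right_diff_distrib sum_subtractf sum_negf sum_distrib_left sum_distrib_right mult_ac)
  then show ?thesis unfolding has_pv_integral_def using 1 2 3 by blast
qed

section \<open>Logarithms of the archimedean factor\<close>

text \<open>
  The difference of two branches takes values in \<open>2 \<pi> i \<int>\<close>, a discrete set, and is continuous
  on a connected line.
\<close>

lemma continuous_log_unique:
  assumes "continuous_log f F" "continuous_log f G"
  obtains k where "\<And>t. F t = G t + k"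
proof -
  let ?d = "\<lambda>t. F t - G t"
  have "?d constant_on UNIV"
  proof (rule continuous_discrete_range_constant)
    show "continuous_on UNIV ?d"
      using assms by (intro continuous_on_diff) (auto simp: continuous_log_def)
    fix x :: real
    have "exp (F t) = exp (G t)" for t using assms by (simp add: continuous_log_def)
    then have exp_d: "exp (?d y - ?d x) = 1" for y by (simp add: exp_diff)
    have "2 * pi \<le> norm (?d y - ?d x)" if "?d y \<noteq> ?d x" for y
    proof -
      obtain j :: int where j: "Re (?d y - ?d x) = 0" "Im (?d y - ?d x) = of_int (2 * j) * pi"
        using exp_d[of y] unfolding exp_eq_1 by blast
      with that have "j \<noteq> 0" by (auto simp: complex_eq_iff)
      then have "1 * (2 * pi) \<le> \<bar>real_of_int j\<bar> * (2 * pi)" by (intro mult_right_mono) auto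
      also have "\<dots> = \<bar>Im (?d y - ?d x)\<bar>" unfolding j(2) by (simp add: abs_mult)
      finally show ?thesis using abs_Im_le_cmod[of "?d y - ?d x"] by linarith
    qed
    then show "\<exists>e>0. \<forall>y. y \<in> UNIV \<and> ?d y \<noteq> ?d x \<longrightarrow> e \<le> norm (?d y - ?d x)"
      by (intro exI[of _ "2 * pi"]) auto
  qed auto
  then obtain k where "\<And>t. ?d t = k" by (auto simp: constant_on_def)
  then have "F t = G t + k" for t by (metis add.commute diff_add_cancel)
  then show thesis by (rule that)
qed

lemma exp_log_Gamma_C:
  assumes "Re w > 0"
  shows "exp (ln_Gamma w - w * of_real (ln (2 * pi))) = Gamma_C w"
proof -
  have "w \<notin> \<int>\<^sub>\<le>\<^sub>0" using assms by (auto elim!: nonpos_Ints_cases)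
  moreover have "complex_of_real (2 * pi) powr (- w) = exp (- (w * of_real (ln (2 * pi))))"
  proof -
    have "Ln (complex_of_real (2 * pi)) = of_real (ln (2 * pi))" by (intro Ln_of_real) simp
    then show ?thesis unfolding powr_def by simp
  qed
  ultimately show ?thesis
    by (simp add: Gamma_C_def Gamma_complex_altdef exp_diff exp_minus divide_inverse)
qed

lemma Im_log_Gamma_C_derivative:
  assumes "a > 0"
  shows "((\<lambda>t. Im (ln_Gamma (Complex a t) - Complex a t * of_real (ln (2 * pi))))
     has_real_derivative (Re (Digamma (Complex a s)) - ln (2 * pi))) (at s)"
proof -
  have line: "(Complex a has_vector_derivative \<i>) (at s)"
  proof -
    have "((\<lambda>t. complex_of_real a + of_real t * \<i>) has_vector_derivative 0 + 1 * \<i>) (at s)"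
      by (auto intro!: derivative_eq_intros has_vector_derivative_of_real)
    moreover have "complex_of_real a + of_real t * \<i> = Complex a t" for t by (simp add: complex_eq_iff)
    ultimately show ?thesis by simp
  qed
  have "Complex a s \<notin> \<real>\<^sub>\<le>\<^sub>0" using assms by (auto simp: complex_nonpos_Reals_iff)
  then have "((\<lambda>w. ln_Gamma w - w * of_real (ln (2 * pi))) has_field_derivative
      Digamma (Complex a s) - of_real (ln (2 * pi))) (at (Complex a s))"
    by (auto intro!: derivative_eq_intros)
  from field_vector_diff_chain_at[OF line this]
  have "((\<lambda>t. Im (ln_Gamma (Complex a t) - Complex a t * of_real (ln (2 * pi)))) has_vector_derivative
      Im (\<i> * (Digamma (Complex a s) - of_real (ln (2 * pi))))) (at s)"
    unfolding o_def by (rule bounded_linear.has_vector_derivative[OF bounded_linear_Im])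
  then show ?thesis by (simp add: has_real_derivative_iff_has_vector_derivative)
qed

section \<open>The trace formula\<close>

context hodge_structure begin

lemma fibre_trace_integrand:
  defines "\<phi> \<equiv> \<lambda>s u. local.endo_trace (canonical_rep u) * of_real (mod_C u) powr critical_point m s / of_real (mod_C (1 - u))"
  assumes "\<nu> > 0" "\<nu> \<noteq> 1"
  shows "has_bochner_integral (fibre_measure \<nu>) (\<phi> s)
    (\<Sum>i\<in>hodge_types m. of_nat (hodge_number (fst i) (snd i)) * mellin_term (nat \<bar>int (snd i) - int (fst i)\<bar>) s \<nu>)"
proof (rule has_bochner_integral_fibre)
  have [measurable]: "cnj \<in> borel_measurable borel"
    by (intro borel_measurable_continuous_onI continuous_intros)
  have powr: "complex_of_real (mod_C u) powr critical_point m s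
      = (if mod_C u = 0 then 0 else exp (critical_point m s * of_real (ln (mod_C u))))" for u
  proof -
    have "mod_C u \<ge> 0" by (simp add: mod_C_eq)
    then show ?thesis by (simp add: powr_def Ln_of_real)
  qed
  have [measurable]: "mod_C \<in> borel_measurable borel"
    unfolding mod_C_eq[abs_def] by measurable
  show "\<phi> s \<in> borel_measurable borel"
    unfolding \<phi>_def endo_trace_canonical_rep powr power_int_minus power_int_of_nat case_prod_beta
    by measurable
  define r where "r = sqrt \<nu>"
  have r: "r > 0" "r \<noteq> 1" "r\<^sup>2 = \<nu>" using assms by (auto simp: r_def)
  have \<phi>_polar: "\<phi> s (of_real (sqrt \<nu>) * cis \<theta>)
      = (\<Sum>i\<in>hodge_types m. of_nat (hodge_number (fst i) (snd i)) * (character s \<nu> * of_real r)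
          * (cis (of_int (int (snd i) - int (fst i)) * \<theta>) / of_real ((norm (1 - of_real r * cis \<theta>))\<^sup>2)))" for \<theta>
  proof -
    \<comment> \<open>the powers of the radius cancel up to a single factor \<open>r\<close>\<close>
    have "inverse (r ^ m) * r ^ Suc m = r" using r by simp
    then have "complex_of_real (inverse (r ^ m)) * of_real (r ^ Suc m) = of_real r"
      by (simp only: of_real_mult[symmetric])
    moreover have "h * (A * c) * (x * B) / N = h * (x * (A * B)) * (c / N)" for h A B c x N :: complex
      by simp
    ultimately have regroup: "h * (of_real (inverse (r ^ m)) * c) * (x * of_real (r ^ Suc m)) / N
        = h * (x * of_real r) * (c / N)" for h c x N :: complex
      by (simp only:)
    have "mod_C (of_real r * cis \<theta>) = \<nu>" using r by (simp add: mod_C_eq norm_mult)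
    then have "\<phi> s (of_real r * cis \<theta>)
        = (\<Sum>i\<in>hodge_types m. of_nat (hodge_number (fst i) (snd i))
            * ((of_real r * cis \<theta>) powi (- int (fst i)) * cnj (of_real r * cis \<theta>) powi (- int (snd i))))
          * (character s \<nu> * of_real (r ^ Suc m)) / of_real ((norm (1 - of_real r * cis \<theta>))\<^sup>2)"
      unfolding \<phi>_def endo_trace_canonical_rep case_prod_beta
      using of_real_powr_critical_point[OF assms(2), of m s] by (simp only: mod_C_eq[of "1 - _"] r_def)
    also have "\<dots> = (\<Sum>i\<in>hodge_types m. of_nat (hodge_number (fst i) (snd i))
            * (of_real (inverse (r ^ m)) * cis (of_int (int (snd i) - int (fst i)) * \<theta>)))
          * (character s \<nu> * of_real (r ^ Suc m)) / of_real ((norm (1 - of_real r * cis \<theta>))\<^sup>2)"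
    proof -
      have "fst i + snd i = m" if "i \<in> hodge_types m" for i
        using that by (auto simp: hodge_types_def)
      then show ?thesis by (simp only: hodge_character_polar[OF r(1)] cong: sum.cong)
    qed
    also have "\<dots> = (\<Sum>i\<in>hodge_types m. of_nat (hodge_number (fst i) (snd i)) * (character s \<nu> * of_real r)
          * (cis (of_int (int (snd i) - int (fst i)) * \<theta>) / of_real ((norm (1 - of_real r * cis \<theta>))\<^sup>2)))"
      unfolding sum_distrib_right sum_divide_distrib
      unfolding regroup by (simp only:)
    finally show ?thesis by (simp only: r_def)
  qed
  have norm_pos: "norm (1 - of_real r * cis \<theta>) \<noteq> 0" for \<theta>
  proof
    assume "norm (1 - of_real r * cis \<theta>) = 0"
    then have "norm (of_real r * cis \<theta>) = 1" by simp
    then show False using r by (simp add: norm_mult)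
  qed
  show "continuous_on {0..2*pi} (\<lambda>\<theta>. \<phi> s (of_real (sqrt \<nu>) * cis \<theta>))"
    unfolding \<phi>_polar using norm_pos by (intro continuous_intros) auto
  have "((\<lambda>\<theta>. \<phi> s (of_real (sqrt \<nu>) * cis \<theta>)) has_integral
      (\<Sum>i\<in>hodge_types m. of_nat (hodge_number (fst i) (snd i)) * (character s \<nu> * of_real r)
        * of_real (2 * pi * (min r (1 / r) ^ nat \<bar>int (snd i) - int (fst i)\<bar> / \<bar>1 - r\<^sup>2\<bar>)))) {0..2*pi}"
    unfolding \<phi>_polar
    by (intro has_integral_sum finite_hodge_types has_integral_mult_right poisson_integral r)
  also have "(\<Sum>i\<in>hodge_types m. of_nat (hodge_number (fst i) (snd i)) * (character s \<nu> * of_real r)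
        * of_real (2 * pi * (min r (1 / r) ^ nat \<bar>int (snd i) - int (fst i)\<bar> / \<bar>1 - r\<^sup>2\<bar>)))
    = of_real (2 * pi) * (\<Sum>i\<in>hodge_types m. of_nat (hodge_number (fst i) (snd i))
        * mellin_term (nat \<bar>int (snd i) - int (fst i)\<bar>) s \<nu>)"
    unfolding sum_distrib_left
    unfolding mellin_term_def f0_sqrt[OF assms(2)] inverse_f1_sqrt[OF assms(2,3)] r(3) r_def[symmetric]
    by (rule sum.cong[OF refl]) simp
  finally show "((\<lambda>\<theta>. \<phi> s (of_real (sqrt \<nu>) * cis \<theta>)) has_integral
      of_real (2 * pi) * (\<Sum>i\<in>hodge_types m. of_nat (hodge_number (fst i) (snd i))
        * mellin_term (nat \<bar>int (snd i) - int (fst i)\<bar>) s \<nu>)) {0..2*pi}" .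
qed

text \<open>
  The real part of \<open>z - min p q\<close> on the critical line, for \<open>i = (p, q)\<close>.
\<close>

definition abscissa :: "nat \<times> nat \<Rightarrow> real" where
  "abscissa i = (1 + real (nat \<bar>int (snd i) - int (fst i)\<bar>)) / 2"

lemma abscissa_pos: "abscissa i > 0"
  by (simp add: abscissa_def)

lemma critical_point_minus_min:
  assumes "i \<in> hodge_types m"
  shows "critical_point m s - of_nat (min (fst i) (snd i)) = Complex (abscissa i) s"
proof -
  have m: "real m = real (fst i) + real (snd i)" using assms by (auto simp: hodge_types_def)
  have "real (nat \<bar>int (snd i) - int (fst i)\<bar>) = \<bar>real (snd i) - real (fst i)\<bar>" by simp
  then have "(1 + real m) / 2 - real (min (fst i) (snd i)) = abscissa i"
    unfolding abscissa_def m by (simp add: min_def field_simps)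
  then show ?thesis by (simp add: critical_point_def complex_eq_iff)
qed

text \<open>
  An explicit branch of \<open>log L_C\<close> along the critical line.  The function \<open>ln_Gamma\<close> is
  holomorphic off the nonpositive reals, while the principal logarithm of \<open>L_C\<close> may jump.
\<close>

definition log_L_C :: "real \<Rightarrow> complex" where
  "log_L_C s = (\<Sum>i\<in>hodge_types m. of_nat (hodge_number (fst i) (snd i))
     * (ln_Gamma (Complex (abscissa i) s) - Complex (abscissa i) s * of_real (ln (2 * pi))))"

lemma log_L_C_is_continuous_log: "continuous_log (\<lambda>s. L_C (critical_point m s)) log_L_C"
  unfolding continuous_log_def
proof
  have line: "continuous_on UNIV (Complex a)" for a
  proof -
    have "Complex a = (\<lambda>t. of_real a + of_real t * \<i>)" by (simp add: complex_eq_iff fun_eq_iff)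
    then show ?thesis by (simp add: continuous_intros)
  qed
  have "continuous_on UNIV (\<lambda>t. ln_Gamma (Complex (abscissa i) t))" for i
  proof (rule continuous_on_compose2[OF continuous_on_ln_Gamma_complex line])
    show "{w. Re w > 0} \<inter> \<real>\<^sub>\<le>\<^sub>0 = {}" by (auto simp: complex_nonpos_Reals_iff)
  qed (auto simp: abscissa_pos)
  with line show "continuous_on UNIV log_L_C"
    unfolding log_L_C_def[abs_def] by (intro continuous_intros) auto
  have "exp (log_L_C s) = (\<Prod>i\<in>hodge_types m. Gamma_C (Complex (abscissa i) s) ^ hodge_number (fst i) (snd i))" for s
    by (simp add: log_L_C_def exp_sum finite_hodge_types exp_of_nat_mult exp_log_Gamma_C abscissa_pos)
  also have "\<dots> s = L_C (critical_point m s)" for s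
    unfolding L_C_def case_prod_beta by (intro prod.cong refl) (simp add: critical_point_minus_min)
  finally show "\<forall>s. exp (log_L_C s) = L_C (critical_point m s)" by blast
qed

lemma Im_log_L_C_derivative:
  "((\<lambda>t. Im (log_L_C t)) has_real_derivative
     (\<Sum>i\<in>hodge_types m. real (hodge_number (fst i) (snd i))
        * (Re (Digamma (Complex (abscissa i) s)) - ln (2 * pi)))) (at s)"
proof -
  have "Im (log_L_C t) = (\<Sum>i\<in>hodge_types m. real (hodge_number (fst i) (snd i))
      * Im (ln_Gamma (Complex (abscissa i) t) - Complex (abscissa i) t * of_real (ln (2 * pi))))" for t
  proof -
    have "Im (of_nat k * z) = real k * Im z" for k z by simp
    then show ?thesis unfolding log_L_C_def Im_sum by (simp only:)
  qed
  then show ?thesis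
    by (simp only:) (intro DERIV_sum DERIV_cmult Im_log_Gamma_C_derivative abscissa_pos)
qed

lemma trace_formula:
  "(\<exists>F. continuous_log (\<lambda>s. L_C (critical_point m s)) F) \<and>
    (\<forall>F. continuous_log (\<lambda>s. L_C (critical_point m s)) F \<longrightarrow>
      (\<forall>s. (\<lambda>t. Im (F t)) differentiable (at s) \<and>
        has_pv_integral
          (\<lambda>u. local.endo_trace (canonical_rep u)
                * of_real (mod_C u) powr critical_point m s / of_real (mod_C (1 - u)))
          (of_real (- 2 * deriv (\<lambda>t. Im (F t)) s))))"
proof (intro conjI allI impI)
  show "\<exists>F. continuous_log (\<lambda>s. L_C (critical_point m s)) F"
    using log_L_C_is_continuous_log by blast
  fix F s assume F: "continuous_log (\<lambda>s. L_C (critical_point m s)) F"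
  let ?D = "\<Sum>i\<in>hodge_types m. real (hodge_number (fst i) (snd i))
        * (Re (Digamma (Complex (abscissa i) s)) - ln (2 * pi))"
  obtain k where "F t = log_L_C t + k" for t
    using continuous_log_unique[OF F log_L_C_is_continuous_log] by blast
  then have deriv: "((\<lambda>t. Im (F t)) has_real_derivative ?D) (at s)"
    using DERIV_add[OF Im_log_L_C_derivative DERIV_const] by simp
  then show "(\<lambda>t. Im (F t)) differentiable (at s)"
    using real_differentiable_def by blast
  have "(\<Sum>i\<in>hodge_types m. of_nat (hodge_number (fst i) (snd i))
        * complex_of_real (2 * ln (2 * pi) - 2 * Re (Digamma (Complex (abscissa i) s)))) = of_real (- 2 * ?D)"
  proof -
    have "of_nat k * of_real (2 * l - 2 * x) = complex_of_real (- 2 * (real k * (x - l)))" for k l x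
      by (simp add: algebra_simps)
    then show ?thesis unfolding sum_distrib_left of_real_sum by (simp only:)
  qed
  then show "has_pv_integral
          (\<lambda>u. local.endo_trace (canonical_rep u)
                * of_real (mod_C u) powr critical_point m s / of_real (mod_C (1 - u)))
          (of_real (- 2 * deriv (\<lambda>t. Im (F t)) s))"
    using has_pv_integral_mellin[OF finite_hodge_types fibre_trace_integrand, of s]
    unfolding DERIV_imp_deriv[OF deriv] abscissa_def by simp
qed

end

theorem theorem7p4:
  fixes scale :: "complex \<Rightarrow> 'a::ab_group_add \<Rightarrow> 'a"
    and cj :: "'a \<Rightarrow> 'a" and m :: nat and H :: "nat \<Rightarrow> nat \<Rightarrow> 'a set"
  assumes "hodge_structure scale cj m H"
  shows "(\<exists>F. continuous_log (\<lambda>s. hodge_structure.L_C scale m H (critical_point m s)) F) \<and>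
    (\<forall>F. continuous_log (\<lambda>s. hodge_structure.L_C scale m H (critical_point m s)) F \<longrightarrow>
      (\<forall>s. (\<lambda>t. Im (F t)) differentiable (at s) \<and>
        has_pv_integral
          (\<lambda>u. vector_space.endo_trace scale (hodge_structure.canonical_rep scale m H u)
                * of_real (mod_C u) powr critical_point m s / of_real (mod_C (1 - u)))
          (of_real (- 2 * deriv (\<lambda>t. Im (F t)) s))))"
  using assms by (rule hodge_structure.trace_formula)

end
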